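(* Let $n,T,d\ge 1$ be integers with $T\ge 3$. For each sample $i\in\{1,\dots,n\}$ let $e^{(i)}_1,\dots,e^{(i)}_T\in\mathbb{R}^{d}$ be context tokens, let $y_i\in\{1,\dots,T-1\}$ be the match index, let the query be $q^{(i)}=e^{(i)}_{y_i}$ (exact match) and let the target be $e^{(i)}_{y_i+1}$ (exact copy). For $w\in\mathbb{R}^{d^2}$ (the flattening of a matrix $W\in\mathbb{R}^{d\times d}$, with the flattening chosen so that $e^\top W q = w^\top\operatorname{flatten}(e\,q^\top)$) set $x_{i,t}:=\operatorname{flatten}(e^{(i)}_t q^{(i)\top})$ for $t=1,\dots,T-1$, and define attention weights $a^{(i)}_1(w)=0$ and $$a^{(i)}_{t+1}(w)=\frac{\exp(w^\top x_{i,t})}{\sum_{s=1}^{T-1}\exp(w^\top x_{i,s})},\qquad t=1,\dots,T-1.$$ Define the loss $$\mathrm{MSE}(w)=\sum_{i=1}^n\frac12\Big\|\sum_{t=1}^T a^{(i)}_t(w)\,e^{(i)}_t-e^{(i)}_{y_i+1}\Big\|^2,$$ and run gradient descent $w(\tau+1)=w(\tau)-\eta\nabla\mathrm{MSE}(w(\tau))$ with a fixed step size $\eta>0$. For $t\in\{1,\dots,T-1\}\setminus\{y_i\}$ let $\tilde x_{i,t}:=x_{i,y_i}-x_{i,t}$ and $d_{i,t}:=e^{(i)}_{t+1}-e^{(i)}_{y_i+1}$, and let $$h_{i,t}(w):=\sum_{s\neq y_i}\langle d_{i,t},d_{i,s}\rangle\,\frac{a^{(i)}_{s+1}(w)}{1-a^{(i)}_{y_i+1}(w)}.$$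 Assume: (A1) the hard-margin problem $\min_w\frac12\|w\|^2$ subject to $w^\top\tilde x_{i,t}\ge 1$ for all $i$ and all $t\neq y_i$ is feasible; let $\hat w$ be its (unique) solution and $\mathcal I_{SV}:=\{(i,t):\hat w^\top\tilde x_{i,t}=1\}$, $\mathcal I_{SV}(i):=\{s:(i,s)\in\mathcal I_{SV}\}$; (A2) the vectors $\{\tilde x_{i,t}:(i,t)\in\mathcal I_{SV}\}$ are linearly independent; write $\hat w=\sum_{(i,t)\in\mathcal I_{SV}}\alpha_{i,t}\tilde x_{i,t}$ for the (KKT) coefficients $\alpha_{i,t}$; (A3) for every $i$, $e^{(i)}_{y_i+1}$ does not lie in the convex hull of $\{e^{(i)}_{t+1}:t\in\{1,\dots,T-1\}, t\neq y_i\}$; (A4) for every $i$ and all $t,s\neq y_i$, $\langle d_{i,t},d_{i,s}\rangle>0$; (A5) $\mathrm{MSE}(w(\tau))\to 0$ as $\tau\to\infty$; (A6) $\sum_{\tau=0}^\infty\|\nabla\mathrm{MSE}(w(\tau))\|^2<\infty$; (A7) for all $(i,t)$ the limit $h^\infty_{i,t}:=\lim_{\tau\to\infty}h_{i,t}(w(\tau))$ exists and $\sum_{\tau\ge1}\tau^{-1}|h_{i,t}(w(\tau))-h^\infty_{i,t}|<\infty$; (A8) let $\tilde w$ be the unique vector in $\operatorname{span}\{\tilde x_{i,t}:(i,t)\in\mathcal I_{SV}\}$ satisfying, for all $(i,t)\in\mathcal I_{SV}$, $$\eta\,h^\infty_{i,t}\,e^{-\tilde w^\top\tilde x_{i,t}}\sum_{s\in\mathcal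 I_{SV}(i)}e^{-\tilde w^\top\tilde x_{i,s}}=\tfrac12\alpha_{i,t};$$ set $p_{i,t}:=e^{-\tilde w^\top\tilde x_{i,t}}$, $r(\tau):=w(\tau)-\tfrac12\log(\tau)\,\hat w-\tilde w$, $u_{i,t}(\tau):=\langle r(\tau),\tilde x_{i,t}\rangle$, $H_{i,t,s}(\tau):=h^\infty_{i,t}u_{i,t}(\tau)+h^\infty_{i,s}u_{i,s}(\tau)$ and $U_{i,t,s}(\tau):=u_{i,t}(\tau)+u_{i,s}(\tau)$. Then there exists $\varepsilon\in(0,1/2)$ such that for all sufficiently large $\tau$ and all $i$, $$\sum_{\substack{s,t\in\mathcal I_{SV}(i),\ s\neq t\\ \operatorname{sign}(H_{i,t,s}(\tau))\neq\operatorname{sign}(U_{i,t,s}(\tau))}}p_{i,t}p_{i,s}|H_{i,t,s}(\tau)|\,|e^{-U_{i,t,s}(\tau)}-1|\le\varepsilon\sum_{\substack{s,t\in\mathcal I_{SV}(i),\ s\neq t}}p_{i,t}p_{i,s}|H_{i,t,s}(\tau)|\,|e^{-U_{i,t,s}(\tau)}-1|;$$ (A9) there exists $g:\mathbb N\to\mathbb R$ with $\sum_\tau g(\tau)\tau^{-1}<\infty$ such that for all $i$ and $\tau$, $$\sum_{s\notin\mathcal I_{SV}(i),\,s\neq y_i}\exp(-w(\tau)^\top\tilde x_{i,s})\le g(\tau)\sum_{s\in\mathcal I_{SV}(i)}\exp(-w(\tau)^\top\tilde x_{i,s}).$$ Then $\|w(\tau)\|\sim\frac{\|\hat w\|}{2}\log(\tau)$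 and $\frac{w(\tau)}{\|w(\tau)\|}\to\frac{\hat w}{\|\hat w\|}$ as $\tau\to\infty$.
   Context: This is gradient descent on the merged key–query matrix $W$ of a single-query attention head whose keys are shifted by one position (attention score of position $t-1$ determines the weight of token $t$) and whose value map is the identity, trained with squared loss on exact match-and-copy data. "Sign" denotes the real sign function. In (A8) the defining equations for $\tilde w$ are required to have a unique solution in the stated span (this is the case when the relevant $h^\infty_{i,t}$ and $\alpha_{i,t}$ are positive). *)

theory Defs
  imports "HOL-Analysis.Analysis" "HOL-Library.Landau_Symbols"
begin

definition grad :: "('a::real_inner \<Rightarrow> real) \<Rightarrow> 'a \<Rightarrow> 'a" where
  "grad f x = (SOME g. GDERIV f x :> g)"

text \<open>Matrices W in R^(d x d) are elements of real^'d^'d; the Frobenius inner product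
  is the library inner product, so W \<bullet> outer e q = e^T W q (flattening).\<close>
definition outer :: "real^'d \<Rightarrow> real^'d \<Rightarrow> real^'d^'d" where
  "outer u v = (\<chi> j k. u$j * v$k)"

text \<open>Samples i in {1..n}, tokens e i t for t in {1..T}, match index y i in {1..T-1}.\<close>
definition xtok :: "(nat \<Rightarrow> nat \<Rightarrow> real^'d) \<Rightarrow> (nat \<Rightarrow> nat) \<Rightarrow> nat \<Rightarrow> nat \<Rightarrow> real^'d^'d" where
  "xtok e y i t = outer (e i t) (e i (y i))"

definition attn :: "nat \<Rightarrow> (nat \<Rightarrow> nat \<Rightarrow> real^'d) \<Rightarrow> (nat \<Rightarrow> nat) \<Rightarrow> nat \<Rightarrow> nat \<Rightarrow> real^'d^'d \<Rightarrow> real" where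
  "attn T e y i t W = (if t = 1 then 0 else
      exp (W \<bullet> xtok e y i (t - 1)) / (\<Sum>s\<in>{1..T-1}. exp (W \<bullet> xtok e y i s)))"

definition mse :: "nat \<Rightarrow> nat \<Rightarrow> (nat \<Rightarrow> nat \<Rightarrow> real^'d) \<Rightarrow> (nat \<Rightarrow> nat) \<Rightarrow> real^'d^'d \<Rightarrow> real" where
  "mse n T e y W = (\<Sum>i\<in>{1..n}. 1/2 * (norm ((\<Sum>t\<in>{1..T}. attn T e y i t W *\<^sub>R e i t) - e i (y i + 1)))^2)"

definition xt :: "(nat \<Rightarrow> nat \<Rightarrow> real^'d) \<Rightarrow> (nat \<Rightarrow> nat) \<Rightarrow> nat \<Rightarrow> nat \<Rightarrow> real^'d^'d" where
  "xt e y i t = xtok e y i (y i) - xtok e y i t"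

definition dd :: "(nat \<Rightarrow> nat \<Rightarrow> real^'d) \<Rightarrow> (nat \<Rightarrow> nat) \<Rightarrow> nat \<Rightarrow> nat \<Rightarrow> real^'d" where
  "dd e y i t = e i (t + 1) - e i (y i + 1)"

definition hfun :: "nat \<Rightarrow> (nat \<Rightarrow> nat \<Rightarrow> real^'d) \<Rightarrow> (nat \<Rightarrow> nat) \<Rightarrow> nat \<Rightarrow> nat \<Rightarrow> real^'d^'d \<Rightarrow> real" where
  "hfun T e y i t W = (\<Sum>s\<in>{1..T-1} - {y i}.
      (dd e y i t \<bullet> dd e y i s) * (attn T e y i (s + 1) W / (1 - attn T e y i (y i + 1) W)))"

definition margin_set :: "nat \<Rightarrow> nat \<Rightarrow> (nat \<Rightarrow> nat \<Rightarrow> real^'d) \<Rightarrow> (nat \<Rightarrow> nat) \<Rightarrow> (real^'d^'d) set" where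
  "margin_set n T e y = {v. \<forall>i\<in>{1..n}. \<forall>t\<in>{1..T-1} - {y i}. 1 \<le> v \<bullet> xt e y i t}"

definition ISV :: "nat \<Rightarrow> nat \<Rightarrow> (nat \<Rightarrow> nat \<Rightarrow> real^'d) \<Rightarrow> (nat \<Rightarrow> nat) \<Rightarrow> real^'d^'d \<Rightarrow> (nat \<times> nat) set" where
  "ISV n T e y wh = {(i, t). i \<in> {1..n} \<and> t \<in> {1..T-1} \<and> t \<noteq> y i \<and> wh \<bullet> xt e y i t = 1}"

definition ISVi :: "nat \<Rightarrow> nat \<Rightarrow> (nat \<Rightarrow> nat \<Rightarrow> real^'d) \<Rightarrow> (nat \<Rightarrow> nat) \<Rightarrow> real^'d^'d \<Rightarrow> nat \<Rightarrow> nat set" where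
  "ISVi n T e y wh i = {s. (i, s) \<in> ISV n T e y wh}"

end

theory Submission
  imports Defs
begin

text \<open>
  Write \<open>z\<^bsub>i,t\<^esub> = exp (- w \<bullet> xt e y i t)\<close> and \<open>Z\<^sub>i = \<Sum>\<^sub>t z\<^bsub>i,t\<^esub>\<close>. The residual of sample \<open>i\<close> is
  \<open>(\<Sum>\<^sub>t z\<^bsub>i,t\<^esub> d\<^bsub>i,t\<^esub>) / (1 + Z\<^sub>i)\<close>, so the loss is \<open>1/2 \<Sum>\<^sub>i q\<^sub>i / (1 + Z\<^sub>i)\<^sup>2\<close>, where
  \<open>q\<^sub>i = \<Sum>\<^sub>t\<^sub>,\<^sub>s (d\<^bsub>i,t\<^esub> \<bullet> d\<^bsub>i,s\<^esub>) exp (- w \<bullet> (xt e y i t + xt e y i s))\<close> is by (A4) a sum of exponentials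
  with positive coefficients. Since the loss tends to 0, so do all \<open>Z\<^sub>i\<close>, and the gradient of
  the loss is \<open>\<nabla>Q + o(Q)\<close> for the surrogate \<open>Q = 1/2 \<Sum>\<^sub>i q\<^sub>i\<close>.

  Let \<open>u = wh / 2\<close>, the shortest vector with \<open>u \<bullet> v \<ge> 1\<close> for every exponent \<open>v\<close> of \<open>Q\<close>. Then
  \<open>Q \<le> norm u * norm (\<nabla>Q)\<close>, while \<open>Q\<close> decreases by about \<open>\<eta> (norm (\<nabla>Q))\<^sup>2\<close> per step. Hence \<open>Q\<close>
  is of exact order \<open>1 / \<tau>\<close>, which forces \<open>w(\<tau>) \<bullet> v \<ge> ln \<tau> - O(1)\<close> for all \<open>v\<close>; and a step has length
  at most \<open>(1 + o(1)) * norm u\<close> times the decrease of \<open>ln Q\<close>, so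
  \<open>norm (w(\<tau>)) \<le> (1 + o(1)) * norm u * ln \<tau>\<close>. By minimality of \<open>u\<close>, \<open>w(\<tau>) / ln \<tau>\<close> tends to \<open>u\<close>.
\<close>

subsection \<open>Real sequences\<close>

text \<open>For negative \<open>x\<close> the bound follows from
  \<open>exp x \<le> 1 / (1 - x)\<close>, since (1 + x + x^2)(1 - x) = 1 - x^3 is then at least
  1.\<close>

lemma exp_le_quadratic:
  fixes x :: real
  assumes "\<bar>x\<bar> \<le> 1"
  shows "exp x \<le> 1 + x + x\<^sup>2"
proof (cases "x \<ge> 0")
  case True
  then show ?thesis using exp_bound[of x] assms by simp
next
  case False
  have "1 - x \<le> exp (- x)" using exp_ge_add_one_self[of "- x"] by simp
  then have "exp x \<le> 1 / (1 - x)"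
    using False by (simp add: exp_minus field_simps)
  also have "\<dots> \<le> 1 + x + x\<^sup>2"
  proof -
    have "(1 + x + x\<^sup>2) * (1 - x) = 1 - x ^ 3" by (simp add: algebra_simps power2_eq_square power3_eq_cube)
    moreover have "x ^ 3 \<le> 0" using False by (simp add: power_le_zero_eq)
    ultimately have "1 \<le> (1 + x + x\<^sup>2) * (1 - x)" by simp
    then show ?thesis using False by (simp add: pos_divide_le_eq)
  qed
  finally show ?thesis .
qed

text \<open>Discrete form of q' = -a q^2: the reciprocal \<open>1 / q k\<close> gains at least
  \<open>a\<close> in every late step, hence grows at least linearly.\<close>

lemma inverse_le_of_quadratic_decrease:
  fixes q :: "nat \<Rightarrow> real"
  assumes pos: "\<And>k. q k > 0" and "a > 0"
    and dec: "\<forall>\<^sub>F k in sequentially. q (Suc k) \<le> q k - a * (q k)\<^sup>2"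
  shows "\<exists>C. \<forall>\<^sub>F k in sequentially. ln (q k) \<le> C - ln (real k)"
proof -
  obtain N where N: "\<And>k. k \<ge> N \<Longrightarrow> q (Suc k) \<le> q k - a * (q k)\<^sup>2"
    using dec by (auto simp: eventually_sequentially)
  have step: "1 / q (Suc k) \<ge> 1 / q k + a" if "k \<ge> N" for k
  proof -
    have "q (Suc k) * (1 + a * q k) \<le> (q k - a * (q k)\<^sup>2) * (1 + a * q k)"
      using N[OF that] pos[of k] \<open>a > 0\<close> by (intro mult_right_mono) (auto intro: add_nonneg_nonneg)
    also have "\<dots> = q k - a\<^sup>2 * (q k) ^ 3" by (simp add: algebra_simps power2_eq_square power3_eq_cube)
    also have "\<dots> \<le> q k" using pos[of k] by simp
    finally show ?thesis using pos[of k] pos[of "Suc k"] by (simp add: field_simps)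
  qed
  have lin: "1 / q (N + j) \<ge> a * real j" for j
  proof (induction j)
    case 0
    then show ?case using pos[of N] by simp
  next
    case (Suc j)
    then show ?case using step[of "N + j"] by (simp add: algebra_simps)
  qed
  \<comment> \<open>From \<open>2 * N + 1\<close> on, \<open>k - N\<close> is at least half of
    \<open>k\<close>, so the late start costs only the factor 2 in \<open>a / 2\<close>.\<close>
  have "ln (q k) \<le> - ln (a / 2) - ln (real k)" if k: "k \<ge> 2 * N + 1" for k
  proof -
    have "a / 2 * real k \<le> a * real (k - N)"
      using k \<open>a > 0\<close> by (simp add: of_nat_diff)
    also have "\<dots> \<le> 1 / q k" using lin[of "k - N"] k by simp
    finally have "ln (a / 2 * real k) \<le> ln (1 / q k)"
      using k \<open>a > 0\<close> pos[of k] by (subst ln_le_cancel_iff) auto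
    then show ?thesis
      using k \<open>a > 0\<close> pos[of k] by (simp add: ln_mult ln_div)
  qed
  then show ?thesis
    by (intro exI[of _ "- ln (a / 2)"]) (auto simp: eventually_sequentially)
qed

text \<open>The companion bound: as soon as \<open>b * q k\<close> is below 1/2, one has 1 / (1 - b
  q) \<le> 1 + 2 b q, so the reciprocal gains at most \<open>2 * b\<close> per step. The limit
  hypothesis supplies this smallness.\<close>

lemma inverse_ge_of_quadratic_decrease:
  fixes q :: "nat \<Rightarrow> real"
  assumes pos: "\<And>k. q k > 0" and lim: "q \<longlonglongrightarrow> 0" and "b > 0"
    and dec: "\<forall>\<^sub>F k in sequentially. q k - b * (q k)\<^sup>2 \<le> q (Suc k)"
  shows "\<exists>C. \<forall>\<^sub>F k in sequentially. - ln (q k) \<le> ln (real k) + C"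
proof -
  have "\<forall>\<^sub>F k in sequentially. q k < 1 / (2 * b)"
    using lim \<open>b > 0\<close> by (intro order_tendstoD) auto
  with dec have "\<forall>\<^sub>F k in sequentially. q k - b * (q k)\<^sup>2 \<le> q (Suc k) \<and> q k < 1 / (2 * b)"
    by eventually_elim simp
  then obtain N where N: "\<And>k. k \<ge> N \<Longrightarrow> q k - b * (q k)\<^sup>2 \<le> q (Suc k)"
      and half: "\<And>k. k \<ge> N \<Longrightarrow> q k < 1 / (2 * b)"
    by (auto simp: eventually_sequentially)
  have step: "1 / q (Suc k) \<le> 1 / q k + 2 * b" if "k \<ge> N" for k
  proof -
    have "0 \<le> b * (q k)\<^sup>2 * (1 - 2 * b * q k)"
      using half[OF that] \<open>b > 0\<close> pos[of k] by (intro mult_nonneg_nonneg) (auto simp: field_simps)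
    also have "\<dots> = (q k - b * (q k)\<^sup>2) * (1 + 2 * b * q k) - q k"
      by (simp add: algebra_simps power2_eq_square power3_eq_cube)
    finally have "q k \<le> (q k - b * (q k)\<^sup>2) * (1 + 2 * b * q k)" by simp
    also have "\<dots> \<le> q (Suc k) * (1 + 2 * b * q k)"
      using N[OF that] pos[of k] \<open>b > 0\<close> by (intro mult_right_mono) (auto intro: add_nonneg_nonneg)
    finally show ?thesis using pos[of k] pos[of "Suc k"] by (simp add: field_simps)
  qed
  have lin: "1 / q (N + j) \<le> 1 / q N + 2 * b * real j" for j
  proof (induction j)
    case (Suc j)
    then show ?case using step[of "N + j"] by (simp add: algebra_simps)
  qed simp
  let ?M = "1 / q N + 2 * b"
  have M: "?M > 0" using pos[of N] \<open>b > 0\<close> by (simp add: add_pos_pos)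
  have "- ln (q k) \<le> ln (real k) + ln ?M" if k: "k \<ge> N + 1" for k
  proof -
    have "1 / q k \<le> 1 / q N + 2 * b * real (k - N)"
      using lin[of "k - N"] k by simp
    also have "\<dots> \<le> real k * (1 / q N) + 2 * b * real k"
    proof (intro add_mono mult_left_mono)
      have "1 * (1 / q N) \<le> real k * (1 / q N)"
        using k pos[of N] by (intro mult_right_mono) auto
      then show "1 / q N \<le> real k * (1 / q N)" by simp
    qed (use \<open>b > 0\<close> in auto)
    also have "\<dots> = real k * ?M" by (simp add: algebra_simps)
    finally have "ln (1 / q k) \<le> ln (real k * ?M)"
      using k M pos[of k] by (subst ln_le_cancel_iff) auto
    moreover have "ln (1 / q k) = - ln (q k)" using pos[of k] by (simp add: ln_div)
    moreover have "ln (real k * ?M) = ln (real k) + ln ?M"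
      using k M by (intro ln_mult_pos) auto
    ultimately show ?thesis by linarith
  qed
  then show ?thesis
    by (intro exI[of _ "ln ?M"]) (auto simp: eventually_sequentially)
qed

subsection \<open>Gradient descent on sums of exponentials\<close>

text \<open>One form with arbitrary index set, weights and exponents serves \<open>mass\<close>,
  \<open>pairs\<close> and the surrogate loss alike.\<close>

definition expsum :: "'k set \<Rightarrow> ('k \<Rightarrow> real) \<Rightarrow> ('k \<Rightarrow> 'a::real_inner) \<Rightarrow> 'a \<Rightarrow> real" where
  "expsum K c v w = (\<Sum>k\<in>K. c k * exp (- (w \<bullet> v k)))"

definition expgrad :: "'k set \<Rightarrow> ('k \<Rightarrow> real) \<Rightarrow> ('k \<Rightarrow> 'a::real_inner) \<Rightarrow> 'a \<Rightarrow> 'a" where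
  "expgrad K c v w = - (\<Sum>k\<in>K. (c k * exp (- (w \<bullet> v k))) *\<^sub>R v k)"

lemma expgrad_inner: "expgrad K c v w \<bullet> x = - (\<Sum>k\<in>K. c k * exp (- (w \<bullet> v k)) * (x \<bullet> v k))"
  unfolding expgrad_def inner_minus_left inner_sum_left inner_scaleR_left
  by (simp add: inner_commute)

lemma GDERIV_sum:
  assumes "\<And>i. i \<in> I \<Longrightarrow> GDERIV (f i) x :> D i"
  shows "GDERIV (\<lambda>x. \<Sum>i\<in>I. f i x) x :> (\<Sum>i\<in>I. D i)"
  using assms by (simp add: gderiv_def inner_sum_right has_derivative_sum)

lemma GDERIV_expsum: "GDERIV (expsum K c v) w :> expgrad K c v w"
proof -
  have "GDERIV (\<lambda>w. \<Sum>k\<in>K. c k * exp (- (w \<bullet> v k))) w :>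
      (\<Sum>k\<in>K. - ((c k * exp (- (w \<bullet> v k))) *\<^sub>R v k))"
    by (intro GDERIV_sum) (auto simp: gderiv_def intro!: derivative_eq_intros)
  moreover have "(\<lambda>w. \<Sum>k\<in>K. c k * exp (- (w \<bullet> v k))) = expsum K c v"
    by (simp add: expsum_def fun_eq_iff)
  ultimately show ?thesis by (simp add: expgrad_def sum_negf)
qed

lemma expsum_pos:
  assumes "finite K" "K \<noteq> {}" "\<And>k. k \<in> K \<Longrightarrow> c k > 0"
  shows "expsum K c v w > 0"
  unfolding expsum_def using assms by (intro sum_pos) auto

lemma norm_expgrad_le:
  assumes "\<And>k. k \<in> K \<Longrightarrow> c k \<ge> 0" "\<And>k. k \<in> K \<Longrightarrow> norm (v k) \<le> B"
  shows "norm (expgrad K c v w) \<le> B * expsum K c v w"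
proof -
  have "norm (expgrad K c v w) \<le> (\<Sum>k\<in>K. norm ((c k * exp (- (w \<bullet> v k))) *\<^sub>R v k))"
    unfolding expgrad_def norm_minus_cancel by (rule norm_sum)
  also have "\<dots> \<le> (\<Sum>k\<in>K. B * (c k * exp (- (w \<bullet> v k))))"
  proof (rule sum_mono)
    fix k assume k: "k \<in> K"
    have "norm ((c k * exp (- (w \<bullet> v k))) *\<^sub>R v k) = (c k * exp (- (w \<bullet> v k))) * norm (v k)"
      using assms(1)[OF k] by simp
    also have "\<dots> \<le> (c k * exp (- (w \<bullet> v k))) * B"
      using assms k by (intro mult_left_mono) auto
    finally show "norm ((c k * exp (- (w \<bullet> v k))) *\<^sub>R v k) \<le> B * (c k * exp (- (w \<bullet> v k)))"
      by (simp add: mult.commute)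
  qed
  finally show ?thesis by (simp add: expsum_def sum_distrib_left)
qed

text \<open>Pairing the negative gradient with \<open>u\<close> weights each term by
  \<open>u \<bullet> v k\<close>, which is at least 1; Cauchy-Schwarz does the rest. The constant
  \<open>norm u\<close> is what later makes the bound on the iterates sharp.\<close>

lemma expsum_le_norm_expgrad:
  assumes "\<And>k. k \<in> K \<Longrightarrow> c k \<ge> 0" "\<And>k. k \<in> K \<Longrightarrow> 1 \<le> u \<bullet> v k"
  shows "expsum K c v w \<le> norm u * norm (expgrad K c v w)"
proof -
  have "expsum K c v w \<le> (\<Sum>k\<in>K. c k * exp (- (w \<bullet> v k)) * (u \<bullet> v k))"
    unfolding expsum_def
  proof (rule sum_mono)
    fix k assume "k \<in> K"
    then have "c k * exp (- (w \<bullet> v k)) * 1 \<le> c k * exp (- (w \<bullet> v k)) * (u \<bullet> v k)"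
      using assms by (intro mult_left_mono) auto
    then show "c k * exp (- (w \<bullet> v k)) \<le> c k * exp (- (w \<bullet> v k)) * (u \<bullet> v k)" by simp
  qed
  also have "\<dots> = (- expgrad K c v w) \<bullet> u" by (simp add: expgrad_inner)
  also have "\<dots> \<le> norm (- expgrad K c v w) * norm u" by (rule norm_cauchy_schwarz)
  finally show ?thesis by (simp add: mult.commute)
qed

text \<open>Convexity: the graph lies above its tangent, termwise by 1 + x \<le> exp x.\<close>

lemma expsum_add_ge:
  assumes "\<And>k. k \<in> K \<Longrightarrow> c k \<ge> 0"
  shows "expsum K c v w + expgrad K c v w \<bullet> \<Delta> \<le> expsum K c v (w + \<Delta>)"
proof -
  have "expsum K c v w + expgrad K c v w \<bullet> \<Delta>
      = (\<Sum>k\<in>K. c k * exp (- (w \<bullet> v k)) * (1 + - (\<Delta> \<bullet> v k)))"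
    by (simp add: expgrad_inner expsum_def sum_subtractf[symmetric] algebra_simps)
  also have "\<dots> \<le> (\<Sum>k\<in>K. c k * exp (- (w \<bullet> v k)) * exp (- (\<Delta> \<bullet> v k)))"
    using assms by (intro sum_mono mult_left_mono exp_ge_add_one_self) auto
  also have "\<dots> = expsum K c v (w + \<Delta>)"
    by (simp add: expsum_def inner_add_left exp_add[symmetric] mult.assoc)
  finally show ?thesis .
qed

text \<open>Smoothness relative to the value: the quadratic error carries the factor
  \<open>expsum K c v w\<close> itself. Along a sequence where this value vanishes the error becomes
  negligible for any fixed step size.\<close>

lemma expsum_add_le:
  assumes c: "\<And>k. k \<in> K \<Longrightarrow> c k \<ge> 0" and B: "\<And>k. k \<in> K \<Longrightarrow> norm (v k) \<le> B"
    and small: "B * norm \<Delta> \<le> 1"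
  shows "expsum K c v (w + \<Delta>) \<le> expsum K c v w + expgrad K c v w \<bullet> \<Delta> + (B * norm \<Delta>)\<^sup>2 * expsum K c v w"
proof -
  have "expsum K c v (w + \<Delta>) = (\<Sum>k\<in>K. c k * exp (- (w \<bullet> v k)) * exp (- (\<Delta> \<bullet> v k)))"
    by (simp add: expsum_def inner_add_left exp_add[symmetric] mult.assoc)
  also have "\<dots> \<le> (\<Sum>k\<in>K. c k * exp (- (w \<bullet> v k)) * (1 + - (\<Delta> \<bullet> v k) + (B * norm \<Delta>)\<^sup>2))"
  proof (intro sum_mono mult_left_mono)
    fix k assume k: "k \<in> K"
    have "\<bar>\<Delta> \<bullet> v k\<bar> \<le> norm \<Delta> * norm (v k)" by (rule Cauchy_Schwarz_ineq2)
    also have "\<dots> \<le> B * norm \<Delta>" using mult_left_mono[OF B[OF k], of "norm \<Delta>"] by (simp add: mult.commute)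
    finally have le: "\<bar>- (\<Delta> \<bullet> v k)\<bar> \<le> B * norm \<Delta>" by simp
    have "(- (\<Delta> \<bullet> v k))\<^sup>2 \<le> (B * norm \<Delta>)\<^sup>2"
      using power_mono[OF le, of 2] by simp
    then show "exp (- (\<Delta> \<bullet> v k)) \<le> 1 + - (\<Delta> \<bullet> v k) + (B * norm \<Delta>)\<^sup>2"
      using exp_le_quadratic[of "- (\<Delta> \<bullet> v k)"] le small by linarith
  qed (use c in auto)
  also have "\<dots> = expsum K c v w + expgrad K c v w \<bullet> \<Delta> + (B * norm \<Delta>)\<^sup>2 * expsum K c v w"
    by (simp add: expgrad_inner expsum_def algebra_simps sum.distrib sum_subtractf sum_distrib_left)
  finally show ?thesis .
qed

section \<open>Convergence to the point of least norm in a polyhedron\<close>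

text \<open>The vector \<open>u\<close> is the projection of 0 onto the polyhedron. Points that are
  almost feasible and almost as short as \<open>u\<close> must be near it, by the obtuse-angle
  property of the projection.\<close>

lemma tendsto_min_norm_feasible:
  fixes V :: "'a::euclidean_space set" and W :: "nat \<Rightarrow> 'a"
  assumes fin: "finite V" and feas: "\<forall>x\<in>V. 1 \<le> u \<bullet> x"
    and min: "\<And>z. \<forall>x\<in>V. 1 \<le> z \<bullet> x \<Longrightarrow> norm u \<le> norm z"
    and upper: "\<And>\<kappa>. \<kappa> > 1 \<Longrightarrow> \<forall>\<^sub>F k in sequentially. norm (W k) \<le> \<kappa> * norm u"
    and lower: "\<And>\<theta> x. \<theta> < 1 \<Longrightarrow> x \<in> V \<Longrightarrow> \<forall>\<^sub>F k in sequentially. \<theta> \<le> W k \<bullet> x"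
  shows "W \<longlonglongrightarrow> u"
proof -
  let ?S = "{z. \<forall>x\<in>V. 1 \<le> z \<bullet> x}"
  have S: "?S = (\<Inter>x\<in>V. {z. x \<bullet> z \<ge> 1})" by (auto simp: inner_commute)
  have "convex ?S" unfolding S by (intro convex_INT convex_halfspace_ge)
  have "closed ?S" unfolding S by (intro closed_INT ballI closed_halfspace_ge)
  have proj: "(norm u)\<^sup>2 \<le> z \<bullet> u" if "z \<in> ?S" for z
  proof -
    have "(0 - u) \<bullet> (z - u) \<le> 0"
      using \<open>convex ?S\<close> \<open>closed ?S\<close> feas that min by (intro any_closest_point_dot) auto
    then show ?thesis by (simp add: inner_diff_right power2_norm_eq_inner inner_commute)
  qed
  have "\<forall>\<^sub>F k in sequentially. (norm (W k - u))\<^sup>2 < \<rho>" if "\<rho> > 0" for \<rho>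
  proof -
    \<comment> \<open>The final estimate is 6 \<epsilon> times the squared norm of \<open>u\<close>;
      the added 1 makes it strictly smaller than \<rho> and keeps the quotient defined when
      \<open>u\<close> is 0.\<close>
    define \<epsilon> where "\<epsilon> = min (1/2) (\<rho> / (6 * ((norm u)\<^sup>2 + 1)))"
    have \<epsilon>: "\<epsilon> > 0" "\<epsilon> \<le> 1/2" "6 * \<epsilon> * ((norm u)\<^sup>2 + 1) \<le> \<rho>"
    proof -
      have p: "(norm u)\<^sup>2 + 1 > 0" by (simp add: add_nonneg_pos)
      then show "\<epsilon> > 0" using that by (auto simp: \<epsilon>_def)
      show "\<epsilon> \<le> 1/2" unfolding \<epsilon>_def by (rule min.cobounded1)
      have "\<epsilon> \<le> \<rho> / (6 * ((norm u)\<^sup>2 + 1))" by (simp add: \<epsilon>_def)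
      then show "6 * \<epsilon> * ((norm u)\<^sup>2 + 1) \<le> \<rho>" using p by (simp add: field_simps)
    qed
    have "\<forall>\<^sub>F k in sequentially. \<forall>x\<in>V. 1 - \<epsilon> \<le> W k \<bullet> x"
      using fin lower \<epsilon> by (intro eventually_ball_finite) auto
    moreover have "\<forall>\<^sub>F k in sequentially. norm (W k) \<le> (1 + \<epsilon>) * norm u"
      using \<epsilon> by (intro upper) auto
    ultimately show ?thesis
    proof eventually_elim
      case (elim k)
      \<comment> \<open>Rescaling turns the almost feasible point into a feasible one, to which
        \<open>proj\<close> applies.\<close>
      have "(1 / (1 - \<epsilon>)) *\<^sub>R W k \<in> ?S" using elim(1) \<epsilon> by (auto simp: field_simps)
      from proj[OF this] have a: "(1 - \<epsilon>) * (norm u)\<^sup>2 \<le> W k \<bullet> u"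
        using \<epsilon> by (simp add: field_simps)
      have b: "(norm (W k))\<^sup>2 \<le> (1 + \<epsilon>)\<^sup>2 * (norm u)\<^sup>2"
        using power_mono[OF elim(2), of 2] by (simp add: power_mult_distrib)
      have "(norm (W k - u))\<^sup>2 = (norm (W k))\<^sup>2 - 2 * (W k \<bullet> u) + (norm u)\<^sup>2"
        by (simp add: power2_norm_eq_inner inner_diff_left inner_diff_right inner_commute)
      also have "\<dots> \<le> (1 + \<epsilon>)\<^sup>2 * (norm u)\<^sup>2 - 2 * ((1 - \<epsilon>) * (norm u)\<^sup>2) + (norm u)\<^sup>2"
        using a b by linarith
      also have "\<dots> = \<epsilon> * (4 + \<epsilon>) * (norm u)\<^sup>2"
        by (simp add: algebra_simps power2_eq_square)
      also have "\<dots> \<le> \<epsilon> * 6 * (norm u)\<^sup>2"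
        using \<epsilon> by (intro mult_right_mono mult_left_mono) auto
      also have "\<dots> < 6 * \<epsilon> * ((norm u)\<^sup>2 + 1)" using \<epsilon> by (simp add: algebra_simps)
      finally show ?case using \<epsilon> by simp
    qed
  qed
  then have "(\<lambda>k. (norm (W k - u))\<^sup>2) \<longlonglongrightarrow> 0"
  proof (intro order_tendstoI)
    fix a :: real assume "a < 0"
    then show "\<forall>\<^sub>F k in sequentially. a < (norm (W k - u))\<^sup>2"
      by (intro always_eventually allI) (rule less_le_trans, auto)
  qed
  then have "(\<lambda>k. sqrt ((norm (W k - u))\<^sup>2)) \<longlonglongrightarrow> sqrt 0" by (rule tendsto_real_sqrt)
  then show ?thesis by (simp add: tendsto_norm_zero_iff LIM_zero_iff)
qed

section \<open>Asymptotics of perturbed gradient descent\<close>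

text \<open>The perturbation is measured against the value of the sum. That value is at most
  \<open>norm u\<close> times the gradient norm, so the perturbation is negligible against the
  gradient step.\<close>

lemma perturbed_gradient_descent_expsum:
  fixes v :: "'k \<Rightarrow> 'a::euclidean_space" and w :: "nat \<Rightarrow> 'a"
  assumes fin: "finite K" and ne: "K \<noteq> {}" and c: "\<And>k. k \<in> K \<Longrightarrow> c k > 0"
    and feas: "\<And>k. k \<in> K \<Longrightarrow> 1 \<le> u \<bullet> v k"
    and min: "\<And>z. (\<And>k. k \<in> K \<Longrightarrow> 1 \<le> z \<bullet> v k) \<Longrightarrow> norm u \<le> norm z"
    and "\<eta> > 0"
    and lim: "(\<lambda>j. expsum K c v (w j)) \<longlonglongrightarrow> 0"
    and step: "\<And>j. norm (w (Suc j) - w j + \<eta> *\<^sub>R expgrad K c v (w j)) \<le> \<delta> j * expsum K c v (w j)"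
    and \<delta>: "\<delta> \<longlonglongrightarrow> 0"
  shows "(\<lambda>j. w j /\<^sub>R ln (real j)) \<longlonglongrightarrow> u"
proof -
  define Q where "Q j = expsum K c v (w j)" for j
  define g where "g j = norm (expgrad K c v (w j))" for j
  define \<Delta> where "\<Delta> j = w (Suc j) - w j" for j
  have Q_pos: "Q j > 0" for j unfolding Q_def using fin ne c by (rule expsum_pos)
  have Q_lim: "Q \<longlonglongrightarrow> 0" using lim by (simp add: Q_def[abs_def])
  have c': "\<And>k. k \<in> K \<Longrightarrow> c k \<ge> 0" using c by (simp add: less_imp_le)
  obtain B where B: "B > 0" "\<And>k. k \<in> K \<Longrightarrow> norm (v k) \<le> B"
    using finite_imp_bounded[OF finite_imageI[OF fin, of v]] by (auto simp: bounded_pos)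
  have g_le: "g j \<le> B * Q j" for j
    unfolding g_def Q_def using c' B(2) by (rule norm_expgrad_le)
  have Q_le: "Q j \<le> norm u * g j" for j
    unfolding g_def Q_def using c' feas by (rule expsum_le_norm_expgrad)
  have u_pos: "norm u > 0" using ne feas by fastforce
  have g_pos: "g j > 0" for j
    using Q_le[of j] Q_pos[of j] u_pos by (smt (verit) mult_nonneg_nonpos)
  have g_ge: "Q j / norm u \<le> g j" for j
    using Q_le[of j] u_pos by (simp add: field_simps)
  have w_Suc: "w (Suc j) = w j + \<Delta> j" for j by (simp add: \<Delta>_def)

  \<comment> \<open>Small \<epsilon> is needed for the sharp norm bound; for the order of
    \<open>Q\<close> the single value 1/2 suffices.\<close>
  have descent: "\<forall>\<^sub>F j in sequentially. norm (\<Delta> j) \<le> (1 + \<epsilon>) * \<eta> * g j \<and>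
      Q (Suc j) \<le> Q j - (1 - \<epsilon>) * \<eta> * (g j)\<^sup>2" if \<epsilon>: "0 < \<epsilon>" "\<epsilon> \<le> 1/2" for \<epsilon>
  proof -
    have "(\<lambda>j. norm (\<delta> j) * norm u) \<longlonglongrightarrow> 0"
      using tendsto_mult_right[OF tendsto_norm[OF \<delta>], of "norm u"] by simp
    then have "\<forall>\<^sub>F j in sequentially. norm (\<delta> j) * norm u < \<epsilon> * \<eta> / 2"
      using \<epsilon> \<open>\<eta> > 0\<close> by (intro order_tendstoD) auto
    \<comment> \<open>This threshold makes the quadratic error at most half of the allowed loss
      \<open>\<epsilon> * \<eta> * (g j)\<^sup>2\<close>; the other half is reserved for the
      perturbation \<open>E\<close>.\<close>
    moreover have "\<forall>\<^sub>F j in sequentially. Q j < \<epsilon> / (8 * B\<^sup>2 * \<eta>)"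
      using \<epsilon> \<open>\<eta> > 0\<close> B(1) by (intro order_tendstoD(2)[OF Q_lim]) auto
    ultimately show ?thesis
    proof eventually_elim
      case (elim j)
      let ?G = "expgrad K c v (w j)"
      define E where "E = \<Delta> j + \<eta> *\<^sub>R ?G"
      have small: "4 * B\<^sup>2 * \<eta> * Q j \<le> \<epsilon> / 2"
        using elim(2) B(1) \<open>\<eta> > 0\<close> by (simp add: field_simps)
      have "norm E \<le> \<delta> j * Q j" using step[of j] by (simp add: E_def Q_def \<Delta>_def)
      also have "\<dots> \<le> norm (\<delta> j) * (norm u * g j)"
        using Q_le[of j] Q_pos[of j] by (intro mult_mono) auto
      also have "\<dots> = (norm (\<delta> j) * norm u) * g j" by simp
      also have "\<dots> \<le> (\<epsilon> * \<eta> / 2) * g j"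
        using elim(1) g_pos[of j] by (intro mult_right_mono) auto
      finally have E: "norm E \<le> (\<epsilon> * \<eta> / 2) * g j" .
      have "norm (\<Delta> j) = norm (E - \<eta> *\<^sub>R ?G)" by (simp add: E_def)
      also have "\<dots> \<le> norm E + \<eta> * g j"
        using norm_triangle_ineq4[of E "\<eta> *\<^sub>R ?G"] \<open>\<eta> > 0\<close> by (simp add: g_def)
      finally have \<Delta>: "norm (\<Delta> j) \<le> (\<epsilon> / 2 + 1) * \<eta> * g j" using E by (simp add: algebra_simps)
      have \<epsilon>g: "\<epsilon> * \<eta> * g j > 0" using \<epsilon> \<open>\<eta> > 0\<close> g_pos[of j] by simp
      have \<Delta>1: "norm (\<Delta> j) \<le> (1 + \<epsilon>) * \<eta> * g j"
        using \<Delta> \<epsilon>g by (simp add: algebra_simps)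
      have "(1 + \<epsilon>) * (\<eta> * g j) \<le> 2 * (\<eta> * g j)"
        using \<epsilon> \<open>\<eta> > 0\<close> g_pos[of j] by (intro mult_right_mono) auto
      then have \<Delta>2: "norm (\<Delta> j) \<le> 2 * \<eta> * g j" using \<Delta>1 by simp
      have B\<Delta>: "B * norm (\<Delta> j) \<le> B * (2 * \<eta> * g j)"
        using \<Delta>2 B(1) by (intro mult_left_mono) auto
      also have "\<dots> \<le> B * (2 * \<eta> * (B * Q j))"
        using g_le[of j] B(1) \<open>\<eta> > 0\<close> by (intro mult_left_mono) auto
      also have "\<dots> \<le> 1" using small \<epsilon> by (simp add: power2_eq_square algebra_simps)
      finally have "Q (Suc j) \<le> Q j + ?G \<bullet> \<Delta> j + (B * norm (\<Delta> j))\<^sup>2 * Q j"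
        unfolding Q_def w_Suc using c' B(2) by (intro expsum_add_le) auto
      moreover have "?G \<bullet> \<Delta> j \<le> - (\<eta> * (g j)\<^sup>2) + (\<epsilon> * \<eta> / 2) * (g j)\<^sup>2"
      proof -
        have "?G \<bullet> \<Delta> j = ?G \<bullet> E - \<eta> * (g j)\<^sup>2"
          by (simp add: E_def inner_add_right g_def power2_norm_eq_inner)
        moreover have "?G \<bullet> E \<le> g j * norm E" unfolding g_def by (rule norm_cauchy_schwarz)
        moreover have "g j * norm E \<le> g j * ((\<epsilon> * \<eta> / 2) * g j)"
          using E g_pos[of j] by (intro mult_left_mono) auto
        ultimately show ?thesis by (simp add: power2_eq_square algebra_simps)
      qed
      moreover have "(B * norm (\<Delta> j))\<^sup>2 * Q j \<le> (\<epsilon> * \<eta> / 2) * (g j)\<^sup>2"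
      proof -
        have "(B * norm (\<Delta> j))\<^sup>2 * Q j \<le> (B * (2 * \<eta> * g j))\<^sup>2 * Q j"
          using B\<Delta> B(1) Q_pos[of j] by (intro mult_right_mono power_mono) auto
        also have "\<dots> = (4 * B\<^sup>2 * \<eta> * Q j) * (\<eta> * (g j)\<^sup>2)"
          by (simp add: power2_eq_square algebra_simps)
        also have "\<dots> \<le> (\<epsilon> / 2) * (\<eta> * (g j)\<^sup>2)"
          using small \<open>\<eta> > 0\<close> by (intro mult_right_mono) auto
        finally show ?thesis by simp
      qed
      ultimately show ?case using \<Delta>1 by (simp add: algebra_simps)
    qed
  qed

  have half: "\<forall>\<^sub>F j in sequentially. norm (\<Delta> j) \<le> (1 + 1/2) * \<eta> * g j \<and>
      Q (Suc j) \<le> Q j - (1 - 1/2) * \<eta> * (g j)\<^sup>2"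
    by (rule descent) auto

  \<comment> \<open>Since \<open>g j\<close> is at least \<open>Q j / norm u\<close>, the guaranteed
    decrease is at least a multiple of the square of \<open>Q j\<close>.\<close>
  obtain C1 where C1: "\<forall>\<^sub>F j in sequentially. ln (Q j) \<le> C1 - ln (real j)"
  proof -
    have "\<forall>\<^sub>F j in sequentially. Q (Suc j) \<le> Q j - \<eta> / (2 * (norm u)\<^sup>2) * (Q j)\<^sup>2"
      using half
    proof eventually_elim
      case (elim j)
      have "(Q j / norm u)\<^sup>2 \<le> (g j)\<^sup>2"
        using g_ge[of j] Q_pos[of j] u_pos by (intro power_mono) auto
      then have "\<eta> / 2 * (Q j / norm u)\<^sup>2 \<le> \<eta> / 2 * (g j)\<^sup>2"
        using \<open>\<eta> > 0\<close> by (intro mult_left_mono) auto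
      then show ?case using elim by (simp add: power_divide)
    qed
    from inverse_le_of_quadratic_decrease[OF Q_pos _ this] show ?thesis
      using that \<open>\<eta> > 0\<close> u_pos by auto
  qed

  \<comment> \<open>By convexity a step lowers \<open>Q\<close> by at most the gradient norm times
    the step length, and \<open>g j \<le> B * Q j\<close> turns this into a multiple of the square
    of \<open>Q j\<close>.\<close>
  obtain C2 where C2: "\<forall>\<^sub>F j in sequentially. - ln (Q j) \<le> ln (real j) + C2"
  proof -
    have "\<forall>\<^sub>F j in sequentially. Q j - 2 * \<eta> * B\<^sup>2 * (Q j)\<^sup>2 \<le> Q (Suc j)"
      using half
    proof eventually_elim
      case (elim j)
      have \<Delta>: "norm (\<Delta> j) \<le> 2 * \<eta> * g j"
        using elim mult_pos_pos[OF \<open>\<eta> > 0\<close> g_pos[of j]] by simp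
      have "- (expgrad K c v (w j) \<bullet> \<Delta> j) \<le> g j * norm (\<Delta> j)"
        using Cauchy_Schwarz_ineq2[of "expgrad K c v (w j)" "\<Delta> j"] by (simp add: g_def)
      also have "\<dots> \<le> g j * (2 * \<eta> * g j)"
        using \<Delta> g_pos[of j] by (intro mult_left_mono) auto
      also have "\<dots> = 2 * \<eta> * (g j)\<^sup>2" by (simp add: power2_eq_square)
      also have "\<dots> \<le> 2 * \<eta> * (B * Q j)\<^sup>2"
        using g_le[of j] g_pos[of j] \<open>\<eta> > 0\<close> by (intro mult_left_mono power_mono) auto
      finally have "- (expgrad K c v (w j) \<bullet> \<Delta> j) \<le> 2 * \<eta> * B\<^sup>2 * (Q j)\<^sup>2"
        by (simp add: power_mult_distrib)
      moreover have "Q j + expgrad K c v (w j) \<bullet> \<Delta> j \<le> Q (Suc j)"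
        unfolding Q_def w_Suc using c' by (rule expsum_add_ge)
      ultimately show ?case by linarith
    qed
    from inverse_ge_of_quadratic_decrease[OF Q_pos Q_lim _ this] show ?thesis
      using that \<open>\<eta> > 0\<close> B(1) by auto
  qed

  have ln_lim: "filterlim (\<lambda>j. ln (real j)) at_top sequentially"
    by (rule filterlim_compose[OF ln_at_top filterlim_real_sequentially])
  have ln_small: "\<forall>\<^sub>F j in sequentially. 0 < ln (real j) \<and> C \<le> \<epsilon> * ln (real j)" if "\<epsilon> > 0" for C \<epsilon>
    using eventually_conj[OF filterlim_at_top_dense[THEN iffD1, OF ln_lim, rule_format, of 0]
        filterlim_at_top[THEN iffD1, OF ln_lim, rule_format, of "C / \<epsilon>"]]
    by eventually_elim (use that in \<open>simp add: field_simps\<close>)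

  show ?thesis
  proof (rule tendsto_min_norm_feasible[where V = "v ` K"])
    fix \<theta> :: real and x assume "\<theta> < 1" "x \<in> v ` K"
    then obtain k where k: "k \<in> K" "x = v k" and \<theta>: "1 - \<theta> > 0" by auto
    show "\<forall>\<^sub>F j in sequentially. \<theta> \<le> (w j /\<^sub>R ln (real j)) \<bullet> x"
      using C1 ln_small[of "1 - \<theta>" "C1 - ln (c k)", OF \<theta>]
    proof eventually_elim
      case (elim j)
      \<comment> \<open>A single term never exceeds the whole sum, so the upper bound on
        \<open>ln (Q j)\<close> becomes a lower bound on each margin.\<close>
      have "c k * exp (- (w j \<bullet> v k)) \<le> Q j"
        unfolding Q_def expsum_def using fin c' k
        by (intro member_le_sum[of k K "\<lambda>k. c k * exp (- (w j \<bullet> v k))"]) auto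
      then have "ln (c k * exp (- (w j \<bullet> v k))) \<le> ln (Q j)"
        using c[OF k(1)] Q_pos[of j] by (subst ln_le_cancel_iff) auto
      then have "ln (c k) - w j \<bullet> v k \<le> ln (Q j)"
        using c[OF k(1)] by (simp add: ln_mult)
      then have "\<theta> * ln (real j) \<le> w j \<bullet> x" using elim k(2) by (simp add: algebra_simps)
      then show ?case using elim by (simp add: field_simps)
    qed
  next
    fix \<kappa> :: real assume \<kappa>: "\<kappa> > 1"
    \<comment> \<open>The slack \<open>8 * \<epsilon>\<close> is spent in two equal parts: one on
      replacing \<open>\<mu>\<close> by \<open>norm u\<close>, one on absorbing the additive
      constant \<open>?C\<close>.\<close>
    define \<epsilon> where "\<epsilon> = min (1/2) ((\<kappa> - 1) / 8)"
    have \<epsilon>: "0 < \<epsilon>" "\<epsilon> \<le> 1/2" "8 * \<epsilon> \<le> \<kappa> - 1"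
      using \<kappa> min.cobounded1[of "1/2" "(\<kappa> - 1) / 8"] min.cobounded2[of "1/2" "(\<kappa> - 1) / 8"]
      by (auto simp: \<epsilon>_def)
    define \<mu> where "\<mu> = (1 + \<epsilon>) / (1 - \<epsilon>) * norm u"
    have \<mu>: "\<mu> \<le> (1 + 4 * \<epsilon>) * norm u" "\<mu> > 0"
    proof -
      have "0 \<le> \<epsilon> * (2 - 4 * \<epsilon>)" using \<epsilon> by (intro mult_nonneg_nonneg) auto
      then have "1 + \<epsilon> \<le> (1 + 4 * \<epsilon>) * (1 - \<epsilon>)" by (simp add: algebra_simps)
      then have "(1 + \<epsilon>) / (1 - \<epsilon>) \<le> 1 + 4 * \<epsilon>" using \<epsilon> by (simp add: pos_divide_le_eq)
      then show "\<mu> \<le> (1 + 4 * \<epsilon>) * norm u" unfolding \<mu>_def by (intro mult_right_mono) auto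
      show "\<mu> > 0" unfolding \<mu>_def using \<epsilon> u_pos by simp
    qed
    \<comment> \<open>The step length is linear in \<open>g j\<close> whereas the decrease of
      \<open>ln Q\<close> is about \<eta> g^2 / Q. The factor \<open>norm u * g j / Q j\<close>, at
      least 1, bridges the two and yields a bound that telescopes.\<close>
    have "\<forall>\<^sub>F j in sequentially. norm (\<Delta> j) \<le> \<mu> * (ln (Q j) - ln (Q (Suc j)))"
      using descent[OF \<epsilon>(1,2)]
    proof eventually_elim
      case (elim j)
      have "ln (Q (Suc j)) - ln (Q j) = ln (Q (Suc j) / Q j)"
        using Q_pos[of j] Q_pos[of "Suc j"] by (simp add: ln_div)
      also have "\<dots> \<le> Q (Suc j) / Q j - 1"
        using Q_pos by (intro ln_le_minus_one) auto
      also have "\<dots> = (Q (Suc j) - Q j) / Q j" using Q_pos[of j] by (simp add: field_simps)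
      also have "\<dots> \<le> - ((1 - \<epsilon>) * \<eta> * (g j)\<^sup>2) / Q j"
        using elim Q_pos[of j] by (intro divide_right_mono) auto
      finally have a: "(1 - \<epsilon>) * \<eta> * (g j)\<^sup>2 / Q j \<le> ln (Q j) - ln (Q (Suc j))" by simp
      have "norm (\<Delta> j) \<le> (1 + \<epsilon>) * \<eta> * g j" using elim by simp
      also have "\<dots> \<le> (1 + \<epsilon>) * \<eta> * g j * (norm u * g j / Q j)"
      proof -
        have "1 \<le> norm u * g j / Q j" using Q_le[of j] Q_pos[of j] by simp
        then have "(1 + \<epsilon>) * \<eta> * g j * 1 \<le> (1 + \<epsilon>) * \<eta> * g j * (norm u * g j / Q j)"
          using \<epsilon> \<open>\<eta> > 0\<close> g_pos[of j] by (intro mult_left_mono) auto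
        then show ?thesis by simp
      qed
      also have "\<dots> = \<mu> * ((1 - \<epsilon>) * \<eta> * (g j)\<^sup>2 / Q j)"
        using \<epsilon> Q_pos[of j] by (simp add: \<mu>_def power2_eq_square)
      also have "\<dots> \<le> \<mu> * (ln (Q j) - ln (Q (Suc j)))"
        using a \<mu>(2) by (intro mult_left_mono) auto
      finally show ?case .
    qed
    then obtain N where N: "\<And>j. j \<ge> N \<Longrightarrow> norm (\<Delta> j) \<le> \<mu> * (ln (Q j) - ln (Q (Suc j)))"
      by (auto simp: eventually_sequentially)
    have path: "norm (w (N + i)) \<le> norm (w N) + \<mu> * (ln (Q N) - ln (Q (N + i)))" for i
    proof (induction i)
      case (Suc i)
      have "norm (w (N + Suc i)) \<le> norm (w (N + i)) + norm (\<Delta> (N + i))"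
        using norm_triangle_ineq[of "w (N + i)" "\<Delta> (N + i)"] by (simp add: w_Suc)
      then show ?case using Suc N[of "N + i"] by (simp add: algebra_simps)
    qed simp
    have \<epsilon>u: "4 * \<epsilon> * norm u > 0" using \<epsilon> u_pos by simp
    let ?C = "norm (w N) + \<mu> * (ln (Q N) + C2)"
    show "\<forall>\<^sub>F j in sequentially. norm (w j /\<^sub>R ln (real j)) \<le> \<kappa> * norm u"
      using C2 ln_small[of "4 * \<epsilon> * norm u" ?C, OF \<epsilon>u] eventually_ge_at_top[of N]
    proof eventually_elim
      case (elim j)
      have "norm (w j) \<le> norm (w N) + \<mu> * (ln (Q N) - ln (Q j))"
        using path[of "j - N"] elim by simp
      also have "\<dots> \<le> norm (w N) + \<mu> * (ln (Q N) + (ln (real j) + C2))"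
        using elim \<mu>(2) by (intro add_left_mono mult_left_mono) auto
      also have "\<dots> = ?C + \<mu> * ln (real j)" by (simp add: algebra_simps)
      also have "\<dots> \<le> 4 * \<epsilon> * norm u * ln (real j) + (1 + 4 * \<epsilon>) * norm u * ln (real j)"
        using elim \<mu>(1) by (intro add_mono mult_right_mono) auto
      also have "\<dots> = (1 + 8 * \<epsilon>) * (norm u * ln (real j))" by (simp add: algebra_simps)
      also have "\<dots> \<le> \<kappa> * (norm u * ln (real j))"
        using \<epsilon> elim u_pos by (intro mult_right_mono) auto
      finally show ?case using elim by (simp add: field_simps)
    qed
  qed (use fin feas min in auto)
qed

subsection \<open>The attention loss\<close>

text \<open>The choice in \<open>grad\<close> is harmless because a derivative determines its
  representing vector.\<close>

lemma grad_eqI: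
  assumes "GDERIV f x :> D"
  shows "grad f x = D"
proof -
  have "GDERIV f x :> grad f x" unfolding grad_def using assms by (rule someI)
  then have "(\<lambda>h. h \<bullet> grad f x) = (\<lambda>h. h \<bullet> D)"
    using assms unfolding gderiv_def by (rule has_derivative_unique)
  then show ?thesis by (metis vector_eq_ldot inner_commute)
qed

section \<open>The loss as a quotient of sums of exponentials\<close>

definition nonmatch :: "nat \<Rightarrow> (nat \<Rightarrow> nat) \<Rightarrow> nat \<Rightarrow> nat set" where
  "nonmatch T y i = {1..T-1} - {y i}"

text \<open>For \<open>y i\<close> in range this is the odds against the match: the attention on the
  other tokens divided by the attention on token \<open>y i + 1\<close>.\<close>

definition mass :: "nat \<Rightarrow> (nat \<Rightarrow> nat \<Rightarrow> real^'d) \<Rightarrow> (nat \<Rightarrow> nat) \<Rightarrow> nat \<Rightarrow> real^'d^'d \<Rightarrow> real" where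
  "mass T e y i = expsum (nonmatch T y i) (\<lambda>_. 1) (xt e y i)"

abbreviation pair_coeff :: "(nat \<Rightarrow> nat \<Rightarrow> real^'d) \<Rightarrow> (nat \<Rightarrow> nat) \<Rightarrow> nat \<Rightarrow> nat \<times> nat \<Rightarrow> real" where
  "pair_coeff e y i \<equiv> \<lambda>(t, s). dd e y i t \<bullet> dd e y i s"

abbreviation pair_xt :: "(nat \<Rightarrow> nat \<Rightarrow> real^'d) \<Rightarrow> (nat \<Rightarrow> nat) \<Rightarrow> nat \<Rightarrow> nat \<times> nat \<Rightarrow> real^'d^'d" where
  "pair_xt e y i \<equiv> \<lambda>(t, s). xt e y i t + xt e y i s"

text \<open>This is the expanded squared norm of the residual before normalisation, which keeps it
  in the form \<open>expsum\<close>.\<close>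

definition pairs :: "nat \<Rightarrow> (nat \<Rightarrow> nat \<Rightarrow> real^'d) \<Rightarrow> (nat \<Rightarrow> nat) \<Rightarrow> nat \<Rightarrow> real^'d^'d \<Rightarrow> real" where
  "pairs T e y i = expsum (nonmatch T y i \<times> nonmatch T y i) (pair_coeff e y i) (pair_xt e y i)"

lemma finite_nonmatch [simp]: "finite (nonmatch T y i)"
  by (simp add: nonmatch_def)

lemma mass_nonneg: "mass T e y i W \<ge> 0"
  by (simp add: mass_def expsum_def sum_nonneg)

text \<open>Numerator and denominator of the softmax are divided by the exponential of the match
  score.\<close>

lemma attn_Suc:
  assumes "y i \<in> {1..T-1}" "t \<ge> 1"
  shows "attn T e y i (t + 1) W = exp (- (W \<bullet> xt e y i t)) / (1 + mass T e y i W)"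
proof -
  have ex: "exp (W \<bullet> xtok e y i s) = exp (W \<bullet> xtok e y i (y i)) * exp (- (W \<bullet> xt e y i s))" for s
    by (simp add: xt_def inner_diff_right exp_add[symmetric])
  have "(\<Sum>s\<in>{1..T-1}. exp (- (W \<bullet> xt e y i s)))
      = exp (- (W \<bullet> xt e y i (y i))) + (\<Sum>s\<in>nonmatch T y i. exp (- (W \<bullet> xt e y i s)))"
    unfolding nonmatch_def using assms(1) by (intro sum.remove) auto
  then have "(\<Sum>s\<in>{1..T-1}. exp (- (W \<bullet> xt e y i s))) = 1 + mass T e y i W"
    by (simp add: mass_def expsum_def xt_def)
  then have "(\<Sum>s\<in>{1..T-1}. exp (W \<bullet> xtok e y i s)) = exp (W \<bullet> xtok e y i (y i)) * (1 + mass T e y i W)"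
    by (subst ex) (simp add: sum_distrib_left[symmetric])
  then show ?thesis using assms(2) ex[of t] by (simp add: attn_def)
qed

lemma attn_residual:
  assumes y: "y i \<in> {1..T-1}"
  shows "(\<Sum>t\<in>{1..T}. attn T e y i t W *\<^sub>R e i t) - e i (y i + 1) =
    (1 / (1 + mass T e y i W)) *\<^sub>R (\<Sum>t\<in>nonmatch T y i. exp (- (W \<bullet> xt e y i t)) *\<^sub>R dd e y i t)"
proof -
  let ?z = "\<lambda>t. exp (- (W \<bullet> xt e y i t))" and ?Z = "mass T e y i W"
  have Z: "1 + ?Z > 0" using mass_nonneg[of T e y i W] by linarith
  \<comment> \<open>Token 1 has attention 0, and the remaining tokens are the successors of the key
    positions.\<close>
  have "{1..T} = insert 1 (Suc ` {1..T-1})"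
  proof -
    have "t \<in> insert 1 (Suc ` {1..T-1})" if "t \<in> {1..T}" for t
    proof (cases "t = 1")
      case False
      then have "t = Suc (t - 1)" "t - 1 \<in> {1..T-1}" using that by auto
      then show ?thesis by blast
    qed simp
    then show ?thesis using y by auto
  qed
  then have "(\<Sum>t\<in>{1..T}. attn T e y i t W *\<^sub>R e i t)
      = attn T e y i 1 W *\<^sub>R e i 1 + (\<Sum>t\<in>Suc ` {1..T-1}. attn T e y i t W *\<^sub>R e i t)"
    by (simp only:) (subst sum.insert, auto)
  also have "\<dots> = (\<Sum>t\<in>{1..T-1}. attn T e y i (t + 1) W *\<^sub>R e i (t + 1))"
  proof -
    have "(\<Sum>t\<in>Suc ` {1..T-1}. attn T e y i t W *\<^sub>R e i t)
        = (\<Sum>t\<in>{1..T-1}. attn T e y i (t + 1) W *\<^sub>R e i (t + 1))"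
      by (subst sum.reindex) (auto simp only: inj_Suc o_def Suc_eq_plus1)
    then show ?thesis by (simp only: attn_def[of T e y i 1]) simp
  qed
  also have "\<dots> = (\<Sum>t\<in>{1..T-1}. (?z t / (1 + ?Z)) *\<^sub>R e i (t + 1))"
    by (intro sum.cong refl arg_cong2[where f = scaleR] attn_Suc y) auto
  also have "\<dots> = (1 / (1 + ?Z)) *\<^sub>R (\<Sum>t\<in>{1..T-1}. ?z t *\<^sub>R e i (t + 1))"
    by (simp add: scaleR_sum_right)
  also have "(\<Sum>t\<in>{1..T-1}. ?z t *\<^sub>R e i (t + 1)) =
      ?z (y i) *\<^sub>R e i (y i + 1) + (\<Sum>t\<in>nonmatch T y i. ?z t *\<^sub>R e i (t + 1))"
    unfolding nonmatch_def using y by (intro sum.remove) auto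
  \<comment> \<open>Writing each token as the target plus \<open>dd e y i t\<close> collects a full
    weight \<open>1 + ?Z\<close> on the target, which cancels after normalisation.\<close>
  also have "\<dots> = (1 + ?Z) *\<^sub>R e i (y i + 1) + (\<Sum>t\<in>nonmatch T y i. ?z t *\<^sub>R dd e y i t)"
    by (simp add: dd_def xt_def mass_def expsum_def scaleR_diff_right sum_subtractf
        scaleR_sum_left[symmetric] scaleR_add_left)
  finally show ?thesis using Z by (simp add: scaleR_add_right)
qed

lemma mse_eq:
  assumes "\<And>i. i \<in> {1..n} \<Longrightarrow> y i \<in> {1..T-1}"
  shows "mse n T e y W = (\<Sum>i\<in>{1..n}. 1/2 * pairs T e y i W * inverse ((1 + mass T e y i W)\<^sup>2))"
  unfolding mse_def
proof (intro sum.cong refl)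
  fix i assume i: "i \<in> {1..n}"
  let ?r = "\<Sum>t\<in>nonmatch T y i. exp (- (W \<bullet> xt e y i t)) *\<^sub>R dd e y i t"
  have "?r \<bullet> ?r = (\<Sum>t\<in>nonmatch T y i. \<Sum>s\<in>nonmatch T y i.
      (dd e y i t \<bullet> dd e y i s) * exp (- (W \<bullet> (xt e y i t + xt e y i s))))"
    unfolding inner_sum_left inner_sum_right
    by (intro sum.cong refl) (simp add: inner_add_right exp_diff exp_minus inner_commute field_simps)
  then have "(norm ?r)\<^sup>2 = pairs T e y i W"
    by (simp add: power2_norm_eq_inner pairs_def expsum_def sum.cartesian_product case_prod_unfold)
  then show "1/2 * (norm ((\<Sum>t\<in>{1..T}. attn T e y i t W *\<^sub>R e i t) - e i (y i + 1)))\<^sup>2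
      = 1/2 * pairs T e y i W * inverse ((1 + mass T e y i W)\<^sup>2)"
    unfolding attn_residual[of y i T e W, OF assms[OF i]] norm_scaleR power_mult_distrib
    by (simp add: power_one_over inverse_eq_divide)
qed

section \<open>The gradient of the loss against that of the surrogate\<close>

lemma GDERIV_half_div_square:
  fixes q Z :: "'a::real_inner \<Rightarrow> real"
  assumes q: "GDERIV q w :> a" and Z: "GDERIV Z w :> b" and "Z w \<ge> 0"
  shows "GDERIV (\<lambda>w. 1/2 * q w * inverse ((1 + Z w)\<^sup>2)) w :>
    (1/2 * inverse ((1 + Z w)\<^sup>2)) *\<^sub>R a - (q w * inverse ((1 + Z w) ^ 3)) *\<^sub>R b"
proof -
  have "DERIV (\<lambda>x. inverse ((1 + x)\<^sup>2)) (Z w) :> - 2 * inverse ((1 + Z w) ^ 3)"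
    using \<open>Z w \<ge> 0\<close>
    by (auto intro!: derivative_eq_intros simp: field_simps power2_eq_square power3_eq_cube add_nonneg_eq_0_iff)
  from GDERIV_DERIV_compose[OF Z this]
  have "GDERIV (\<lambda>w. inverse ((1 + Z w)\<^sup>2)) w :> (- 2 * inverse ((1 + Z w) ^ 3)) *\<^sub>R b" .
  from GDERIV_mult[OF GDERIV_mult[OF GDERIV_const q] this]
  show ?thesis by (rule GDERIV_subst) simp
qed

text \<open>Two errors of size at most \<open>B * q * Z\<close> arise: one from replacing the
  denominator by 1, one from differentiating it.\<close>

lemma grad_half_div_square_close:
  fixes a b :: "'a::real_inner"
  assumes "Z \<ge> 0" "q \<ge> 0" "norm a \<le> B * q" "norm b \<le> B * Z"
  shows "norm ((1/2 * inverse ((1 + Z)\<^sup>2)) *\<^sub>R a - (q * inverse ((1 + Z) ^ 3)) *\<^sub>R b - (1/2) *\<^sub>R a)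
    \<le> 2 * B * q * Z"
proof -
  have le1: "inverse ((1 + Z)\<^sup>2) \<le> 1" "inverse ((1 + Z) ^ 3) \<le> 1"
    using \<open>Z \<ge> 0\<close> by (auto intro!: le_imp_inverse_le[of 1, simplified] one_le_power)
  have gap: "1 - inverse ((1 + Z)\<^sup>2) \<le> 2 * Z"
  proof -
    have "(1 - 2 * Z) * (1 + Z)\<^sup>2 = 1 - 3 * Z\<^sup>2 - 2 * Z ^ 3"
      by (simp add: power2_eq_square power3_eq_cube algebra_simps)
    also have "\<dots> \<le> 1" using \<open>Z \<ge> 0\<close> by (smt (verit) zero_le_power)
    finally show ?thesis using \<open>Z \<ge> 0\<close> by (simp add: field_simps add_pos_nonneg)
  qed
  have "norm ((1/2 * inverse ((1 + Z)\<^sup>2)) *\<^sub>R a - (q * inverse ((1 + Z) ^ 3)) *\<^sub>R b - (1/2) *\<^sub>R a)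
      = norm ((1/2 * (inverse ((1 + Z)\<^sup>2) - 1)) *\<^sub>R a - (q * inverse ((1 + Z) ^ 3)) *\<^sub>R b)"
    by (simp add: algebra_simps)
  also have "\<dots> \<le> norm ((1/2 * (inverse ((1 + Z)\<^sup>2) - 1)) *\<^sub>R a) + norm ((q * inverse ((1 + Z) ^ 3)) *\<^sub>R b)"
    by (rule norm_triangle_ineq4)
  also have "\<dots> = 1/2 * (1 - inverse ((1 + Z)\<^sup>2)) * norm a + q * inverse ((1 + Z) ^ 3) * norm b"
    using le1 assms by (simp add: abs_mult)
  also have "\<dots> \<le> 1/2 * (2 * Z) * (B * q) + q * 1 * (B * Z)"
    using gap le1 assms by (intro add_mono mult_mono) auto
  finally show ?thesis by (simp add: algebra_simps)
qed

text \<open>Sample and pair are merged into one index, so that half the sum of all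
  \<open>pairs\<close> is a single \<open>expsum\<close>.\<close>

definition surrogate_index :: "nat \<Rightarrow> nat \<Rightarrow> (nat \<Rightarrow> nat) \<Rightarrow> (nat \<times> nat \<times> nat) set" where
  "surrogate_index n T y = (SIGMA i:{1..n}. nonmatch T y i \<times> nonmatch T y i)"

abbreviation surrogate_coeff :: "(nat \<Rightarrow> nat \<Rightarrow> real^'d) \<Rightarrow> (nat \<Rightarrow> nat) \<Rightarrow> nat \<times> nat \<times> nat \<Rightarrow> real" where
  "surrogate_coeff e y \<equiv> \<lambda>(i, k). 1/2 * pair_coeff e y i k"

abbreviation surrogate_xt :: "(nat \<Rightarrow> nat \<Rightarrow> real^'d) \<Rightarrow> (nat \<Rightarrow> nat) \<Rightarrow> nat \<times> nat \<times> nat \<Rightarrow> real^'d^'d" where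
  "surrogate_xt e y \<equiv> \<lambda>(i, k). pair_xt e y i k"

lemma surrogate_eq:
  "expsum (surrogate_index n T y) (surrogate_coeff e y) (surrogate_xt e y) W
    = (\<Sum>i\<in>{1..n}. 1/2 * pairs T e y i W)"
  unfolding expsum_def surrogate_index_def pairs_def sum_distrib_left
  by (subst sum.Sigma) (auto simp: case_prod_unfold mult.assoc)

lemma surrogate_grad_eq:
  "expgrad (surrogate_index n T y) (surrogate_coeff e y) (surrogate_xt e y) W
    = (\<Sum>i\<in>{1..n}. (1/2) *\<^sub>R expgrad (nonmatch T y i \<times> nonmatch T y i) (pair_coeff e y i) (pair_xt e y i) W)"
  unfolding expgrad_def surrogate_index_def scaleR_minus_right scaleR_sum_right sum_negf
  by (subst sum.Sigma) (auto simp: case_prod_unfold mult.assoc)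

text \<open>The error is the surrogate times the total mass, hence of smaller order than the
  surrogate once the masses vanish; \<open>B\<close> does not depend on \<open>W\<close>.\<close>

lemma grad_mse_close:
  fixes e :: "nat \<Rightarrow> nat \<Rightarrow> real^'d"
  assumes y: "\<And>i. i \<in> {1..n} \<Longrightarrow> y i \<in> {1..T-1}"
    and d: "\<And>i t s. i \<in> {1..n} \<Longrightarrow> t \<in> nonmatch T y i \<Longrightarrow> s \<in> nonmatch T y i \<Longrightarrow> dd e y i t \<bullet> dd e y i s > 0"
  shows "\<exists>B. \<forall>W. norm (grad (mse n T e y) W
      - expgrad (surrogate_index n T y) (surrogate_coeff e y) (surrogate_xt e y) W)
    \<le> B * (\<Sum>i\<in>{1..n}. mass T e y i W)
        * expsum (surrogate_index n T y) (surrogate_coeff e y) (surrogate_xt e y) W"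
proof -
  have "finite ((\<lambda>(i, t). xt e y i t) ` (SIGMA i:{1..n}. nonmatch T y i))" by auto
  from finite_imp_bounded[OF this] obtain M where M0: "M > 0"
      "\<forall>x \<in> (\<lambda>(i, t). xt e y i t) ` (SIGMA i:{1..n}. nonmatch T y i). norm x \<le> M"
    unfolding bounded_pos by blast
  have M: "M > 0" "\<And>i t. i \<in> {1..n} \<Longrightarrow> t \<in> nonmatch T y i \<Longrightarrow> norm (xt e y i t) \<le> M"
    using M0 by auto
  \<comment> \<open>The exponents of \<open>pairs\<close> are sums of two vectors \<open>xt\<close>,
    hence the doubled bound.\<close>
  define B where "B = 2 * M"
  have B1: "norm (xt e y i t) \<le> B" if "i \<in> {1..n}" "t \<in> nonmatch T y i" for i t
    using M(2)[OF that] M(1) by (simp add: B_def)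
  have B2: "norm (xt e y i t + xt e y i s) \<le> B"
    if "i \<in> {1..n}" "t \<in> nonmatch T y i" "s \<in> nonmatch T y i" for i t s
    using norm_triangle_ineq[of "xt e y i t" "xt e y i s"] M(2)[of i t] M(2)[of i s] that
    by (simp add: B_def)
  have bound: "norm (grad (mse n T e y) W
      - expgrad (surrogate_index n T y) (surrogate_coeff e y) (surrogate_xt e y) W)
    \<le> 4 * B * (\<Sum>i\<in>{1..n}. mass T e y i W)
        * expsum (surrogate_index n T y) (surrogate_coeff e y) (surrogate_xt e y) W" for W
  proof -
    define a where "a i = expgrad (nonmatch T y i \<times> nonmatch T y i) (pair_coeff e y i) (pair_xt e y i) W" for i
    define b where "b i = expgrad (nonmatch T y i) (\<lambda>_. 1) (xt e y i) W" for i
    define q where "q i = pairs T e y i W" for i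
    define Z where "Z i = mass T e y i W" for i
    define R where "R = (\<Sum>i\<in>{1..n}. Z i)"
    let ?D = "\<lambda>i. (1/2 * inverse ((1 + Z i)\<^sup>2)) *\<^sub>R a i - (q i * inverse ((1 + Z i) ^ 3)) *\<^sub>R b i"
    have Z: "Z i \<ge> 0" for i by (simp add: Z_def mass_nonneg)
    have q: "q i \<ge> 0" if "i \<in> {1..n}" for i
      unfolding q_def pairs_def expsum_def using d[OF that] by (intro sum_nonneg) (auto simp: less_imp_le)
    have "GDERIV (\<lambda>W. \<Sum>i\<in>{1..n}. 1/2 * pairs T e y i W * inverse ((1 + mass T e y i W)\<^sup>2)) W :>
        (\<Sum>i\<in>{1..n}. ?D i)"
      unfolding q_def Z_def a_def b_def
      by (intro GDERIV_sum GDERIV_half_div_square mass_nonneg)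
        (simp_all add: pairs_def mass_def GDERIV_expsum)
    moreover have "mse n T e y
        = (\<lambda>W. \<Sum>i\<in>{1..n}. 1/2 * pairs T e y i W * inverse ((1 + mass T e y i W)\<^sup>2))"
      using y by (intro ext mse_eq)
    ultimately have "GDERIV (mse n T e y) W :> (\<Sum>i\<in>{1..n}. ?D i)" by (simp only:)
    then have "grad (mse n T e y) W = (\<Sum>i\<in>{1..n}. ?D i)" by (rule grad_eqI)
    then have "norm (grad (mse n T e y) W
        - expgrad (surrogate_index n T y) (surrogate_coeff e y) (surrogate_xt e y) W)
        = norm (\<Sum>i\<in>{1..n}. ?D i - (1/2) *\<^sub>R a i)"
      by (simp only: surrogate_grad_eq a_def sum_subtractf)
    also have "\<dots> \<le> (\<Sum>i\<in>{1..n}. 2 * B * q i * Z i)"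
    proof (rule sum_norm_le)
      fix i assume i: "i \<in> {1..n}"
      have "norm (a i) \<le> B * q i"
        unfolding a_def q_def pairs_def
        by (rule norm_expgrad_le) (auto simp: B2[OF i] d[OF i] less_imp_le)
      moreover have "norm (b i) \<le> B * Z i"
        unfolding b_def Z_def mass_def by (rule norm_expgrad_le) (auto simp: B1[OF i])
      ultimately show "norm (?D i - (1/2) *\<^sub>R a i) \<le> 2 * B * q i * Z i"
        using Z q[OF i] by (intro grad_half_div_square_close)
    qed
    \<comment> \<open>Replacing each mass by the total \<open>R\<close> lets the sum factor. The
      constant then doubles to \<open>4 * B\<close> because the surrogate carries the factor
      1/2.\<close>
    also have "\<dots> \<le> (\<Sum>i\<in>{1..n}. 2 * B * q i * R)"
    proof (intro sum_mono mult_left_mono)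
      fix i assume i: "i \<in> {1..n}"
      then show "Z i \<le> R" unfolding R_def using Z by (intro member_le_sum) auto
      show "0 \<le> 2 * B * q i" using q[OF i] M(1) by (simp add: B_def)
    qed
    also have "\<dots> = 4 * B * R * (\<Sum>i\<in>{1..n}. 1/2 * q i)"
      by (simp add: sum_distrib_left mult_ac)
    finally show ?thesis by (simp only: surrogate_eq q_def Z_def R_def)
  qed
  then show ?thesis by blast
qed

section \<open>Vanishing loss and the logarithmic limit\<close>

text \<open>The loss controls only \<open>pairs\<close> divided by the square of
  \<open>1 + mass\<close>. By (A4) \<open>pairs\<close> dominates a multiple of the squared mass, so
  this quotient alone forces the mass to 0, and then the denominator can be cleared.\<close>

lemma mse_tendsto_0_imp:
  fixes e :: "nat \<Rightarrow> nat \<Rightarrow> real^'d"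
  assumes y: "\<And>i. i \<in> {1..n} \<Longrightarrow> y i \<in> {1..T-1}"
    and d: "\<And>i t s. i \<in> {1..n} \<Longrightarrow> t \<in> nonmatch T y i \<Longrightarrow> s \<in> nonmatch T y i \<Longrightarrow> dd e y i t \<bullet> dd e y i s > 0"
    and lim: "((\<lambda>j. mse n T e y (w j)) \<longlongrightarrow> 0) F" and i: "i \<in> {1..n}"
  shows "((\<lambda>j. mass T e y i (w j)) \<longlongrightarrow> 0) F" "((\<lambda>j. pairs T e y i (w j)) \<longlongrightarrow> 0) F"
proof -
  define q where "q k j = pairs T e y k (w j)" for k j
  define Z where "Z j = mass T e y i (w j)" for j
  have Z: "Z j \<ge> 0" for j by (simp add: Z_def mass_nonneg)
  have q: "q k j \<ge> 0" if "k \<in> {1..n}" for k j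
    unfolding q_def pairs_def expsum_def using d[OF that] by (intro sum_nonneg) (auto simp: less_imp_le)
  have "1/2 * q i j * inverse ((1 + Z j)\<^sup>2) \<le> mse n T e y (w j)" for j
  proof -
    have "mse n T e y (w j) = (\<Sum>i\<in>{1..n}. 1/2 * q i j * inverse ((1 + mass T e y i (w j))\<^sup>2))"
      unfolding q_def using y by (rule mse_eq)
    then show ?thesis
      unfolding Z_def using i q
      by (simp only:) (intro member_le_sum[of i _ "\<lambda>i. 1/2 * q i j * inverse ((1 + mass T e y i (w j))\<^sup>2)"], auto)
  qed
  then have "((\<lambda>j. 1/2 * q i j * inverse ((1 + Z j)\<^sup>2)) \<longlongrightarrow> 0) F"
    using q[OF i] by (intro tendsto_sandwich[OF _ _ tendsto_const lim] always_eventually) auto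
  from tendsto_mult_right[OF this, of 2]
  have ratio: "((\<lambda>j. q i j * inverse ((1 + Z j)\<^sup>2)) \<longlongrightarrow> 0) F" by (simp add: mult_ac)

  \<comment> \<open>The inserted 1 keeps the minimum defined and positive even for an empty index
    set.\<close>
  define m where "m = Min (insert 1 (pair_coeff e y i ` (nonmatch T y i \<times> nonmatch T y i)))"
  have m: "m > 0" unfolding m_def using d[OF i] by (subst Min_gr_iff) auto
  have m_le: "m \<le> dd e y i t \<bullet> dd e y i s" if "t \<in> nonmatch T y i" "s \<in> nonmatch T y i" for t s
    unfolding m_def using that by (intro Min_le) force+
  have mZ: "m * (Z j)\<^sup>2 \<le> q i j" for j
  proof -
    have "(Z j)\<^sup>2 = (\<Sum>t\<in>nonmatch T y i. \<Sum>s\<in>nonmatch T y i.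
        exp (- (w j \<bullet> (xt e y i t + xt e y i s))))"
      by (simp add: Z_def mass_def expsum_def power2_eq_square sum_product inner_add_right
          exp_add[symmetric])
    then have "m * (Z j)\<^sup>2 = (\<Sum>(t, s)\<in>nonmatch T y i \<times> nonmatch T y i.
        m * exp (- (w j \<bullet> (xt e y i t + xt e y i s))))"
      by (simp only: sum.cartesian_product sum_distrib_left case_prod_unfold)
    also have "\<dots> \<le> q i j"
      unfolding q_def pairs_def expsum_def by (intro sum_mono) (auto intro!: m_le mult_right_mono)
    finally show ?thesis .
  qed
  have "((\<lambda>j. (Z j / (1 + Z j))\<^sup>2) \<longlongrightarrow> 0) F"
  proof (rule tendsto_sandwich[OF _ _ tendsto_const])
    show "((\<lambda>j. 1 / m * (q i j * inverse ((1 + Z j)\<^sup>2))) \<longlongrightarrow> 0) F"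
      using tendsto_mult_left[OF ratio, of "1 / m"] by simp
    have "(Z j / (1 + Z j))\<^sup>2 \<le> 1 / m * (q i j * inverse ((1 + Z j)\<^sup>2))" for j
    proof -
      have "(Z j)\<^sup>2 \<le> 1 / m * q i j" using mZ[of j] m by (simp add: field_simps)
      then have "(Z j)\<^sup>2 * inverse ((1 + Z j)\<^sup>2) \<le> 1 / m * q i j * inverse ((1 + Z j)\<^sup>2)"
        by (intro mult_right_mono) auto
      then show ?thesis by (simp add: power_mult_distrib power_inverse divide_inverse mult_ac)
    qed
    then show "\<forall>\<^sub>F j in F. (Z j / (1 + Z j))\<^sup>2 \<le> 1 / m * (q i j * inverse ((1 + Z j)\<^sup>2))" by simp
  qed simp
  then have "((\<lambda>j. sqrt ((Z j / (1 + Z j))\<^sup>2)) \<longlongrightarrow> sqrt 0) F" by (rule tendsto_real_sqrt)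
  then have x: "((\<lambda>j. Z j / (1 + Z j)) \<longlongrightarrow> 0) F" using Z by simp
  \<comment> \<open>The mass is not yet known to be bounded, so it is recovered from x = Z / (1 + Z)
    through the inverse map x / (1 - x), continuous at 0.\<close>
  have "((\<lambda>j. (Z j / (1 + Z j)) / (1 - Z j / (1 + Z j))) \<longlongrightarrow> 0 / (1 - 0)) F"
    by (intro tendsto_intros x) auto
  moreover have "(Z j / (1 + Z j)) / (1 - Z j / (1 + Z j)) = Z j" for j
    using Z[of j] by (simp add: field_simps add_nonneg_eq_0_iff)
  ultimately have Z_lim: "(Z \<longlongrightarrow> 0) F" by simp
  then show "((\<lambda>j. mass T e y i (w j)) \<longlongrightarrow> 0) F" by (simp add: Z_def[abs_def])
  have "((\<lambda>j. q i j * inverse ((1 + Z j)\<^sup>2) * (1 + Z j)\<^sup>2) \<longlongrightarrow> 0 * (1 + 0)\<^sup>2) F"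
    by (intro tendsto_intros ratio Z_lim)
  moreover have "q i j * inverse ((1 + Z j)\<^sup>2) * (1 + Z j)\<^sup>2 = q i j" for j
    using Z[of j] by (simp add: add_nonneg_eq_0_iff)
  ultimately have "((\<lambda>j. q i j) \<longlongrightarrow> 0 * (1 + 0)\<^sup>2) F" by (simp only:)
  then show "((\<lambda>j. pairs T e y i (w j)) \<longlongrightarrow> 0) F" by (simp add: q_def)
qed

text \<open>The norm is continuous, and \<open>sgn\<close> is continuous away from 0 and blind to
  the positive factor \<open>ln (real j)\<close>.\<close>

lemma direction_and_norm_of_log_limit:
  fixes w :: "nat \<Rightarrow> 'a::real_normed_vector"
  assumes lim: "(\<lambda>j. w j /\<^sub>R ln (real j)) \<longlonglongrightarrow> u" and "u \<noteq> 0"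
  shows "(\<lambda>j. norm (w j)) \<sim>[sequentially] (\<lambda>j. norm u * ln (real j))"
    and "(\<lambda>j. w j /\<^sub>R norm (w j)) \<longlonglongrightarrow> u /\<^sub>R norm u"
proof -
  have ln_pos: "\<forall>\<^sub>F j in sequentially. ln (real j) > 0"
    using eventually_gt_at_top[of 1] by eventually_elim simp
  have "(\<lambda>j. norm (w j /\<^sub>R ln (real j)) / norm u) \<longlonglongrightarrow> norm u / norm u"
    using \<open>u \<noteq> 0\<close> by (intro tendsto_intros lim) auto
  moreover have "\<forall>\<^sub>F j in sequentially.
      norm (w j /\<^sub>R ln (real j)) / norm u = norm (w j) / (norm u * ln (real j))"
    using ln_pos by eventually_elim (simp add: field_simps)
  ultimately have "(\<lambda>j. norm (w j) / (norm u * ln (real j))) \<longlonglongrightarrow> 1"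
    using \<open>u \<noteq> 0\<close> by (simp add: filterlim_cong)
  then show "(\<lambda>j. norm (w j)) \<sim>[sequentially] (\<lambda>j. norm u * ln (real j))"
    by (rule asymp_equivI')
  have "(\<lambda>j. sgn (w j /\<^sub>R ln (real j))) \<longlonglongrightarrow> sgn u" using lim \<open>u \<noteq> 0\<close> by (rule tendsto_sgn)
  moreover have "\<forall>\<^sub>F j in sequentially. sgn (w j /\<^sub>R ln (real j)) = sgn (w j)"
    using ln_pos by eventually_elim (simp add: sgn_scaleR)
  ultimately have "(\<lambda>j. sgn (w j)) \<longlonglongrightarrow> sgn u" by (rule Lim_transform_eventually)
  then show "(\<lambda>j. w j /\<^sub>R norm (w j)) \<longlonglongrightarrow> u /\<^sub>R norm u" by (simp only: sgn_div_norm)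
qed

theorem theorem3:
  fixes n T :: nat
    and e :: "nat \<Rightarrow> nat \<Rightarrow> real^'d"
    and y :: "nat \<Rightarrow> nat"
    and \<eta> :: real
    and w :: "nat \<Rightarrow> real^'d^'d"
    and wh wt :: "real^'d^'d"
    and \<alpha> hinf :: "nat \<Rightarrow> nat \<Rightarrow> real"
  assumes n_ge: "n \<ge> 1" and T_ge: "T \<ge> 3"
    and y_range: "\<forall>i\<in>{1..n}. y i \<in> {1..T-1}"
    and eta_pos: "\<eta> > 0"
    and GD: "\<forall>\<tau>. w (Suc \<tau>) = w \<tau> - \<eta> *\<^sub>R grad (mse n T e y) (w \<tau>)"
    \<comment> \<open>(A1): wh is the solution of the (feasible) hard-margin problem\<close>
    and A1: "wh \<in> margin_set n T e y" "\<forall>v\<in>margin_set n T e y. norm wh \<le> norm v"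
    \<comment> \<open>(A2)\<close>
    and A2: "inj_on (\<lambda>(i, t). xt e y i t) (ISV n T e y wh)"
            "independent ((\<lambda>(i, t). xt e y i t) ` ISV n T e y wh)"
    and A2_alpha: "wh = (\<Sum>(i, t)\<in>ISV n T e y wh. \<alpha> i t *\<^sub>R xt e y i t)"
    \<comment> \<open>(A3)\<close>
    and A3: "\<forall>i\<in>{1..n}. e i (y i + 1) \<notin> convex hull {e i (t + 1) | t. t \<in> {1..T-1} \<and> t \<noteq> y i}"
    \<comment> \<open>(A4)\<close>
    and A4: "\<forall>i\<in>{1..n}. \<forall>t\<in>{1..T-1} - {y i}. \<forall>s\<in>{1..T-1} - {y i}. dd e y i t \<bullet> dd e y i s > 0"
    \<comment> \<open>(A5)\<close>
    and A5: "(\<lambda>\<tau>. mse n T e y (w \<tau>)) \<longlonglongrightarrow> 0"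
    \<comment> \<open>(A6)\<close>
    and A6: "summable (\<lambda>\<tau>. (norm (grad (mse n T e y) (w \<tau>)))^2)"
    \<comment> \<open>(A7)\<close>
    and A7: "\<forall>i\<in>{1..n}. \<forall>t\<in>{1..T-1} - {y i}.
               (\<lambda>\<tau>. hfun T e y i t (w \<tau>)) \<longlonglongrightarrow> hinf i t \<and>
               summable (\<lambda>\<tau>. \<bar>hfun T e y i t (w (Suc \<tau>)) - hinf i t\<bar> / real (Suc \<tau>))"
    \<comment> \<open>(A8): wt is the unique solution in the span\<close>
    and A8_span: "wt \<in> span ((\<lambda>(i, t). xt e y i t) ` ISV n T e y wh)"
    and A8_eq: "\<forall>(i, t)\<in>ISV n T e y wh.
               \<eta> * hinf i t * exp (- (wt \<bullet> xt e y i t)) *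
                 (\<Sum>s\<in>ISVi n T e y wh i. exp (- (wt \<bullet> xt e y i s))) = \<alpha> i t / 2"
    and A8_unique: "\<forall>v\<in>span ((\<lambda>(i, t). xt e y i t) ` ISV n T e y wh).
               (\<forall>(i, t)\<in>ISV n T e y wh.
                  \<eta> * hinf i t * exp (- (v \<bullet> xt e y i t)) *
                    (\<Sum>s\<in>ISVi n T e y wh i. exp (- (v \<bullet> xt e y i s))) = \<alpha> i t / 2)
               \<longrightarrow> v = wt"
    and A8: "let p = (\<lambda>i t. exp (- (wt \<bullet> xt e y i t)));
                 r = (\<lambda>\<tau>. w \<tau> - (ln (real \<tau>) / 2) *\<^sub>R wh - wt);
                 u = (\<lambda>i t \<tau>. r \<tau> \<bullet> xt e y i t);
                 H = (\<lambda>i t s \<tau>. hinf i t * u i t \<tau> + hinf i s * u i s \<tau>);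
                 U = (\<lambda>i t s \<tau>. u i t \<tau> + u i s \<tau>)
             in \<exists>\<epsilon>. 0 < \<epsilon> \<and> \<epsilon> < 1/2 \<and>
                (\<forall>\<^sub>F \<tau> in sequentially. \<forall>i\<in>{1..n}.
                  (\<Sum>(s, t)\<in>{(s, t). s \<in> ISVi n T e y wh i \<and> t \<in> ISVi n T e y wh i \<and> s \<noteq> t
                                   \<and> sgn (H i t s \<tau>) \<noteq> sgn (U i t s \<tau>)}.
                     p i t * p i s * \<bar>H i t s \<tau>\<bar> * \<bar>exp (- U i t s \<tau>) - 1\<bar>)
                  \<le> \<epsilon> * (\<Sum>(s, t)\<in>{(s, t). s \<in> ISVi n T e y wh i \<and> t \<in> ISVi n T e y wh i \<and> s \<noteq> t}.
                     p i t * p i s * \<bar>H i t s \<tau>\<bar> * \<bar>exp (- U i t s \<tau>) - 1\<bar>))"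
    \<comment> \<open>(A9)\<close>
    and A9: "\<exists>g :: nat \<Rightarrow> real. summable (\<lambda>\<tau>. g \<tau> / real \<tau>) \<and>
               (\<forall>i\<in>{1..n}. \<forall>\<tau>.
                  (\<Sum>s\<in>({1..T-1} - {y i}) - ISVi n T e y wh i. exp (- (w \<tau> \<bullet> xt e y i s)))
                  \<le> g \<tau> * (\<Sum>s\<in>ISVi n T e y wh i. exp (- (w \<tau> \<bullet> xt e y i s))))"
  shows "((\<lambda>\<tau>. norm (w \<tau>)) \<sim>[sequentially] (\<lambda>\<tau>. norm wh / 2 * ln (real \<tau>))) \<and>
         ((\<lambda>\<tau>. w \<tau> /\<^sub>R norm (w \<tau>)) \<longlonglongrightarrow> wh /\<^sub>R norm wh)"
proof -
  let ?K = "surrogate_index n T y" and ?c = "surrogate_coeff e y" and ?v = "surrogate_xt e y"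
  have y: "\<And>i. i \<in> {1..n} \<Longrightarrow> y i \<in> {1..T-1}" using y_range by blast
  have d: "\<And>i t s. i \<in> {1..n} \<Longrightarrow> t \<in> nonmatch T y i \<Longrightarrow> s \<in> nonmatch T y i
      \<Longrightarrow> dd e y i t \<bullet> dd e y i s > 0"
    using A4 by (auto simp: nonmatch_def)
  have wh_feas: "1 \<le> wh \<bullet> xt e y i t" if "i \<in> {1..n}" "t \<in> nonmatch T y i" for i t
    using A1(1) that by (auto simp: margin_set_def nonmatch_def)
  obtain t where t: "t \<in> nonmatch T y 1"
  \<comment> \<open>With \<open>T \<ge> 3\<close> there are at least two key positions, so one
    differs from the match; its margin constraint then excludes \<open>wh = 0\<close>.\<close>
  proof -
    have "(if y 1 = 1 then 2 else 1) \<in> nonmatch T y 1" using T_ge by (auto simp: nonmatch_def)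
    then show ?thesis by (rule that)
  qed
  then have "wh \<noteq> 0" using wh_feas[of 1 t] n_ge by auto
  obtain B where B: "\<And>W. norm (grad (mse n T e y) W - expgrad ?K ?c ?v W)
      \<le> B * (\<Sum>i\<in>{1..n}. mass T e y i W) * expsum ?K ?c ?v W"
    using grad_mse_close[of n y T e, OF y d] by blast
  have "(\<lambda>j. w j /\<^sub>R ln (real j)) \<longlonglongrightarrow> (1/2) *\<^sub>R wh"
  proof (rule perturbed_gradient_descent_expsum)
    show "finite ?K" by (simp add: surrogate_index_def)
    show "?K \<noteq> {}" using n_ge t by (force simp: surrogate_index_def)
    show "\<And>k. k \<in> ?K \<Longrightarrow> ?c k > 0" by (auto simp: surrogate_index_def d)
    \<comment> \<open>Each surrogate exponent adds two constraint vectors, so half of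
      \<open>wh\<close> already reaches margin 1.\<close>
    show "1 \<le> (1/2) *\<^sub>R wh \<bullet> ?v k" if "k \<in> ?K" for k
    proof -
      obtain i t s where k: "k = (i, t, s)" "i \<in> {1..n}" "t \<in> nonmatch T y i" "s \<in> nonmatch T y i"
        using \<open>k \<in> ?K\<close> by (auto simp: surrogate_index_def)
      then show ?thesis
        using wh_feas[of i t] wh_feas[of i s] by (simp add: inner_add_right)
    qed
    show "norm ((1/2) *\<^sub>R wh) \<le> norm z" if z: "\<And>k. k \<in> ?K \<Longrightarrow> 1 \<le> z \<bullet> ?v k" for z
    proof -
      \<comment> \<open>Conversely, the diagonal pairs \<open>(i, t, t)\<close> show that
        \<open>2 *\<^sub>R z\<close> is feasible for the original margin problem, where
        \<open>wh\<close> has least norm.\<close>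
      have "1 \<le> (2 *\<^sub>R z) \<bullet> xt e y i t" if "i \<in> {1..n}" "t \<in> nonmatch T y i" for i t
        using z[of "(i, t, t)", unfolded prod.case inner_add_right] that
        by (simp add: surrogate_index_def)
      then have "2 *\<^sub>R z \<in> margin_set n T e y" by (simp add: margin_set_def nonmatch_def)
      then have "norm wh \<le> norm (2 *\<^sub>R z)" using A1(2) by blast
      then show ?thesis by simp
    qed
    show "\<eta> > 0" by (rule eta_pos)
    have "(\<lambda>j. \<Sum>i\<in>{1..n}. 1/2 * pairs T e y i (w j)) \<longlonglongrightarrow> (\<Sum>i\<in>{1..n}. 1/2 * 0)"
      by (intro tendsto_sum tendsto_mult tendsto_const mse_tendsto_0_imp(2)[OF y d A5])
    then show "(\<lambda>j. expsum ?K ?c ?v (w j)) \<longlonglongrightarrow> 0" by (simp only: surrogate_eq mult_zero_right sum.neutral_const)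
    \<comment> \<open>The relative perturbation is \<eta> B times the total mass, which vanishes
      with the loss.\<close>
    have "(\<lambda>j. \<eta> * (B * (\<Sum>i\<in>{1..n}. mass T e y i (w j)))) \<longlonglongrightarrow> \<eta> * (B * (\<Sum>i\<in>{1..n}. 0))"
      by (intro tendsto_sum tendsto_mult tendsto_const mse_tendsto_0_imp(1)[OF y d A5])
    then show "(\<lambda>j. \<eta> * (B * (\<Sum>i\<in>{1..n}. mass T e y i (w j)))) \<longlonglongrightarrow> 0" by simp
    show "norm (w (Suc j) - w j + \<eta> *\<^sub>R expgrad ?K ?c ?v (w j))
        \<le> \<eta> * (B * (\<Sum>i\<in>{1..n}. mass T e y i (w j))) * expsum ?K ?c ?v (w j)" for j
    proof -
      have "w (Suc j) - w j + \<eta> *\<^sub>R expgrad ?K ?c ?v (w j)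
          = (- \<eta>) *\<^sub>R (grad (mse n T e y) (w j) - expgrad ?K ?c ?v (w j))"
        using GD by (simp add: scaleR_diff_right)
      then have "norm (w (Suc j) - w j + \<eta> *\<^sub>R expgrad ?K ?c ?v (w j))
          = \<eta> * norm (grad (mse n T e y) (w j) - expgrad ?K ?c ?v (w j))"
        using eta_pos by (simp only: norm_scaleR abs_minus_cancel abs_of_pos)
      also have "\<dots> \<le> \<eta> * (B * (\<Sum>i\<in>{1..n}. mass T e y i (w j)) * expsum ?K ?c ?v (w j))"
        using B eta_pos by (intro mult_left_mono) auto
      finally show ?thesis by (simp only: mult.assoc)
    qed
  qed
  from direction_and_norm_of_log_limit[OF this] \<open>wh \<noteq> 0\<close>
  show ?thesis by (simp add: inverse_eq_divide)
qed

end
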